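(* Let $\mathfrak{n}$ be an $\mathbb{N}$-graded filiform real Lie algebra of dimension $8$. Then $\mathfrak{n}$ is isomorphic to one and only one of the following Lie algebras $(\mathbb{R}^8,\mu)$, where $\{e_1,\dots,e_8\}$ is the canonical basis of $\mathbb{R}^8$: (1) $\mathfrak{m}_0(8)$: $\mu(e_1,e_i)=e_{i+1}$ for $i=2,\dots,7$. (2) $\mathfrak{m}_1(8)$: $\mu(e_1,e_i)=e_{i+1}$ for $i=2,\dots,7$; $\mu(e_i,e_{9-i})=(-1)^i e_8$ for $i=2,\dots,7$. (3) $\mathfrak{m}_2(8)$: $\mu(e_1,e_i)=e_{i+1}$ for $i=2,\dots,7$; $\mu(e_2,e_i)=e_{i+2}$ for $i=3,\dots,6$. (4) $\mathfrak{g}_\alpha(8)$, $\alpha\in\mathbb{R}$: $\mu(e_1,e_i)=e_{i+1}$ for $i=2,\dots,7$; $\mu(e_2,e_3)=(2+\alpha)e_5$, $\mu(e_2,e_4)=(2+\alpha)e_6$, $\mu(e_2,e_5)=(1+\alpha)e_7$, $\mu(e_2,e_6)=\alpha e_8$, $\mu(e_3,e_4)=e_7$, $\mu(e_3,e_5)=e_8$. (5) $\mathfrak{a}_t(8)$, $t\in\mathbb{R}$: $\mu(e_1,e_i)=e_{i+1}$ for $i=2,\dots,7$; $\mu(e_2,e_3)=(t+1)e_6$, $\mu(e_2,e_4)=(t+1)e_7$, $\mu(e_2,e_5)=t e_8$, $\mu(e_3,e_4)=e_8$. (6) $\mathfrak{c}_{1,0}(8)$: $\mu(e_1,e_i)=e_{i+1}$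 for $i=2,\dots,7$; $\mu(e_2,e_3)=e_6$, $\mu(e_2,e_4)=e_7$, $\mu(e_2,e_5)=e_8$. (7) $\mathfrak{d}_1(8)$: $\mu(e_1,e_i)=e_{i+1}$ for $i=2,\dots,7$; $\mu(e_2,e_3)=e_7$, $\mu(e_2,e_4)=e_8$. (8) $\mathfrak{h}_1(8)$: $\mu(e_1,e_i)=e_{i+1}$ for $i=2,\dots,7$; $\mu(e_2,e_3)=e_8$. (9) $\mathfrak{b}(8)$: $\mu(e_1,e_i)=e_{i+1}$ for $i=2,\dots,6$; $\mu(e_2,e_3)=-\tfrac12 e_5$, $\mu(e_2,e_4)=-\tfrac12 e_6$, $\mu(e_2,e_5)=-\tfrac32 e_7$, $\mu(e_3,e_4)=e_7$; $\mu(e_i,e_{9-i})=(-1)^{i+1}e_8$ for $i=2,3,4$. (10) $\mathfrak{k}_1(8)$: $\mu(e_1,e_i)=e_{i+1}$ for $i=2,\dots,6$; $\mu(e_2,e_3)=e_6$, $\mu(e_2,e_4)=e_7$; $\mu(e_i,e_{9-i})=(-1)^{i+1}e_8$ for $i=2,3,4$. (11) $\mathfrak{s}_1(8)$: $\mu(e_1,e_i)=e_{i+1}$ for $i=2,\dots,6$; $\mu(e_2,e_3)=e_7$; $\mu(e_i,e_{9-i})=(-1)^{i+1}e_8$ for $i=2,3,4$. (In the families (4) and (5), different values of the parameter count as different algebras of the list.)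
   Context: All Lie algebras are real and finite-dimensional. Brackets are skew-symmetric and bilinear; brackets of basis vectors that are neither listed nor obtained from the listed ones by skew-symmetry are zero. A Lie algebra $\mathfrak{n}$ of dimension $n$ is filiform if it is $(n-1)$-step nilpotent. A nilpotent Lie algebra $\mathfrak{n}$ is $\mathbb{N}$-graded if it admits a vector space decomposition $\mathfrak{n}=\mathfrak{n}_1\oplus\cdots\oplus\mathfrak{n}_r$ (indices are positive integers, some $\mathfrak{n}_i$ may be zero, and $\mathfrak{n}_k=0$ for $k>r$) such that $[\mathfrak{n}_i,\mathfrak{n}_j]\subset\mathfrak{n}_{i+j}$ for all $i,j$. *)

theory Defs
  imports "HOL-Analysis.Analysis"
begin

locale real_lie_algebra =
  fixes br :: "'a::real_vector \<Rightarrow> 'a \<Rightarrow> 'a"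
  assumes bilinear: "bilinear br"
    and skew: "br x y = - br y x"
    and jacobi: "br x (br y z) + br y (br z x) + br z (br x y) = 0"

definition lie_isomorphic ::
    "('a::real_vector \<Rightarrow> 'a \<Rightarrow> 'a) \<Rightarrow> ('b::real_vector \<Rightarrow> 'b \<Rightarrow> 'b) \<Rightarrow> bool" where
  "lie_isomorphic br br' \<longleftrightarrow>
     (\<exists>f. linear f \<and> bij f \<and> (\<forall>x y. f (br x y) = br' (f x) (f y)))"

primrec lower_central :: "('a::real_vector \<Rightarrow> 'a \<Rightarrow> 'a) \<Rightarrow> nat \<Rightarrow> 'a set" where
  "lower_central br 0 = UNIV"
| "lower_central br (Suc k) = span {br x y | x y. y \<in> lower_central br k}"

definition step_nilpotent :: "nat \<Rightarrow> ('a::real_vector \<Rightarrow> 'a \<Rightarrow> 'a) \<Rightarrow> bool" where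
  "step_nilpotent k br \<longleftrightarrow>
     lower_central br k = {0} \<and> (\<forall>j<k. lower_central br j \<noteq> {0})"

definition filiform :: "('a::real_vector \<Rightarrow> 'a \<Rightarrow> 'a) \<Rightarrow> bool" where
  "filiform br \<longleftrightarrow> step_nilpotent (dim (UNIV :: 'a set) - 1) br"

text \<open>The unique existence of the family \<open>v\<close> of components expresses that the space is the
  (internal) direct sum of \<open>V 1, \<dots>, V r\<close>. The value \<open>V 0\<close> plays no role.\<close>

definition N_graded :: "('a::real_vector \<Rightarrow> 'a \<Rightarrow> 'a) \<Rightarrow> bool" where
  "N_graded br \<longleftrightarrow>
     (\<exists>(r::nat) (V :: nat \<Rightarrow> 'a set).
        (\<forall>i\<ge>1. subspace (V i)) \<and>
        (\<forall>k>r. V k = {0}) \<and>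
        (\<forall>x. \<exists>!v. v \<in> (\<Pi>\<^sub>E i\<in>{1..r}. V i) \<and> x = (\<Sum>i=1..r. v i)) \<and>
        (\<forall>i\<ge>1. \<forall>j\<ge>1. \<forall>x\<in>V i. \<forall>y\<in>V j. br x y \<in> V (i + j)))"

text \<open>The canonical basis is indexed by \<open>1, \<dots>, 8\<close> as natural numbers. In the index type \<open>8\<close>
  the numeral 8 equals 0, so \<open>of_nat\<close> maps \<open>{1..8}\<close> bijectively onto it, but
  the order of the index type is not the order of the subscripts.\<close>

definition eb :: "nat \<Rightarrow> real^8" where
  "eb i = axis (of_nat i) 1"

datatype label =
  L_m0 | L_m1 | L_m2 | L_g real | L_a real | L_c10 | L_d1 | L_h1 | L_b | L_k1 | L_s1

text \<open>An entry \<open>((i, j), v)\<close> stands for the listed bracket $\mu(e_i, e_j) = v$.\<close>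

definition chain :: "nat \<Rightarrow> ((nat \<times> nat) \<times> (real^8)) list" where
  "chain m = map (\<lambda>i. ((1, i), eb (i + 1))) [2..<Suc m]"

fun listed :: "label \<Rightarrow> ((nat \<times> nat) \<times> (real^8)) list" where
  "listed L_m0 = chain 7"
| "listed L_m1 = chain 7 @ map (\<lambda>i. ((i, 9 - i), (-1) ^ i *\<^sub>R eb 8)) [2..<8]"
| "listed L_m2 = chain 7 @ map (\<lambda>i. ((2, i), eb (i + 2))) [3..<7]"
| "listed (L_g \<alpha>) = chain 7 @
     [((2, 3), (2 + \<alpha>) *\<^sub>R eb 5), ((2, 4), (2 + \<alpha>) *\<^sub>R eb 6), ((2, 5), (1 + \<alpha>) *\<^sub>R eb 7),
      ((2, 6), \<alpha> *\<^sub>R eb 8), ((3, 4), eb 7), ((3, 5), eb 8)]"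
| "listed (L_a t) = chain 7 @
     [((2, 3), (t + 1) *\<^sub>R eb 6), ((2, 4), (t + 1) *\<^sub>R eb 7), ((2, 5), t *\<^sub>R eb 8), ((3, 4), eb 8)]"
| "listed L_c10 = chain 7 @ [((2, 3), eb 6), ((2, 4), eb 7), ((2, 5), eb 8)]"
| "listed L_d1 = chain 7 @ [((2, 3), eb 7), ((2, 4), eb 8)]"
| "listed L_h1 = chain 7 @ [((2, 3), eb 8)]"
| "listed L_b = chain 6 @
     [((2, 3), (- 1 / 2) *\<^sub>R eb 5), ((2, 4), (- 1 / 2) *\<^sub>R eb 6), ((2, 5), (- 3 / 2) *\<^sub>R eb 7),
      ((3, 4), eb 7)] @
     map (\<lambda>i. ((i, 9 - i), (-1) ^ (i + 1) *\<^sub>R eb 8)) [2..<5]"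
| "listed L_k1 = chain 6 @ [((2, 3), eb 6), ((2, 4), eb 7)] @
     map (\<lambda>i. ((i, 9 - i), (-1) ^ (i + 1) *\<^sub>R eb 8)) [2..<5]"
| "listed L_s1 = chain 6 @ [((2, 3), eb 7)] @
     map (\<lambda>i. ((i, 9 - i), (-1) ^ (i + 1) *\<^sub>R eb 8)) [2..<5]"

definition basis_bracket :: "label \<Rightarrow> nat \<Rightarrow> nat \<Rightarrow> real^8" where
  "basis_bracket L i j =
     (case map_of (listed L) (i, j) of
        Some v \<Rightarrow> v
      | None \<Rightarrow> (case map_of (listed L) (j, i) of Some v \<Rightarrow> - v | None \<Rightarrow> 0))"

definition mu :: "label \<Rightarrow> real^8 \<Rightarrow> real^8 \<Rightarrow> real^8" where
  "mu L x y = (\<Sum>i=1..8. \<Sum>j=1..8. (x $ of_nat i * y $ of_nat j) *\<^sub>R basis_bracket L i j)"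

lemma atLeastAtMost_1_8: "{1..8::nat} = {1, 2, 3, 4, 5, 6, 7, 8}"
  by auto

lemma of_nat_8_eq_iff:
  assumes "i \<in> {1..8}" "j \<in> {1..8}"
  shows "(of_nat i :: 8) = of_nat j \<longleftrightarrow> i = j"
  using assms unfolding atLeastAtMost_1_8 by auto

lemma mu_basis:
  assumes "i \<in> {1..8}" "j \<in> {1..8}"
  shows "mu L (eb i) (eb j) = basis_bracket L i j"
proof -
  have "mu L (eb i) (eb j) =
      (\<Sum>k=1..8. \<Sum>l=1..8. if l = j then if k = i then basis_bracket L k l else 0 else 0)"
    unfolding mu_def eb_def
    using assms by (intro sum.cong refl) (auto simp: axis_def of_nat_8_eq_iff)
  also have "\<dots> = basis_bracket L i j"
    using assms by (simp add: sum.delta)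
  finally show ?thesis .
qed

lemma mu_listed:
  assumes "((i, j), v) \<in> set (listed L)"
  shows "mu L (eb i) (eb j) = v"
proof -
  have "i \<in> {1..8} \<and> j \<in> {1..8}"
    using assms by (cases L) (auto simp: chain_def)
  moreover have "distinct (map fst (listed L))"
    by (cases L) (simp_all add: chain_def upt_rec)
  then have "basis_bracket L i j = v"
    using assms by (simp add: basis_bracket_def)
  ultimately show ?thesis
    by (simp add: mu_basis)
qed

end

theory Submission
  imports Defs
begin

text \<open>A grading makes the algebra carry a diagonalizable derivation \<open>T\<close> with positive eigenvalues. The
  lower central series of a filiform algebra drops by one dimension at each step after the first, so
  two eigenvectors \<open>e\<^sub>1, e\<^sub>2\<close> of \<open>T\<close> that generate the algebra, suitably chosen, give a basis
  of eigenvectors \<open>e\<^sub>3 = [e\<^sub>1, e\<^sub>2], \<dots>, e\<^sub>7 = [e\<^sub>1, e\<^sub>6], e\<^sub>8\<close>. The Jacobi identity leaves eight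
  structure constants, and comparing the eigenvalues of \<open>T\<close> kills all but one or two of them;
  rescaling \<open>e\<^sub>2\<close> yields the list. Conversely, an isomorphism between two such algebras respects the
  filtration by the spans of \<open>e\<^sub>i, \<dots>, e\<^sub>8\<close>, so its leading coefficients transform the structure
  constants by explicit nonzero factors, which separates the list.\<close>

subsection \<open>Brackets in coordinates\<close>

lemma UNIV_8: "(UNIV :: 8 set) = {1, 2, 3, 4, 5, 6, 7, 0}"
proof -
  have "card {1, 2, 3, 4, 5, 6, 7, 0 :: 8} = CARD(8)" by simp
  then show ?thesis by (metis card_subset_eq finite subset_UNIV)
qed

lemma forall_8: "(\<forall>i::8. P i) \<longleftrightarrow> P 1 \<and> P 2 \<and> P 3 \<and> P 4 \<and> P 5 \<and> P 6 \<and> P 7 \<and> P 0"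
  using UNIV_8 by (metis UNIV_I empty_iff insert_iff)

definition vec8 :: "real \<Rightarrow> real \<Rightarrow> real \<Rightarrow> real \<Rightarrow> real \<Rightarrow> real \<Rightarrow> real \<Rightarrow> real \<Rightarrow> real^8" where
  "vec8 a b c d e f g h = (\<chi> i. if i = 1 then a else if i = 2 then b else if i = 3 then c
     else if i = 4 then d else if i = 5 then e else if i = 6 then f else if i = 7 then g else h)"

lemma vec8_nth [simp]:
  "vec8 a b c d e f g h $ 1 = a" "vec8 a b c d e f g h $ 2 = b" "vec8 a b c d e f g h $ 3 = c"
  "vec8 a b c d e f g h $ 4 = d" "vec8 a b c d e f g h $ 5 = e" "vec8 a b c d e f g h $ 6 = f"
  "vec8 a b c d e f g h $ 7 = g" "vec8 a b c d e f g h $ 0 = h"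
  by (simp_all add: vec8_def)

text \<open>The coordinate \<open>x $ 0\<close> is that of \<open>e\<^sub>8\<close>, since \<open>8 = 0\<close> in the index type, and
  \<open>p i j\<close> is the coefficient of the bracket of \<open>e\<^sub>i\<close> and \<open>e\<^sub>j\<close>. In a suitable basis, an 8-dimensional filiform Lie
  algebra is determined by \<open>[e\<^sub>1, e\<^sub>7] = \<nu> e\<^sub>8\<close>, \<open>[e\<^sub>3, e\<^sub>6] = \<tau> e\<^sub>8\<close>,
  \<open>[e\<^sub>2, e\<^sub>3] = u2 e\<^sub>5 + u3 e\<^sub>6 + u4 e\<^sub>7 + u5 e\<^sub>8\<close> and \<open>[e\<^sub>3, e\<^sub>4] = s2 e\<^sub>7 + s3 e\<^sub>8\<close>: the other
  brackets follow by repeatedly applying the derivation \<open>ad e\<^sub>1\<close>. If the algebra is graded, a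
  nonzero \<open>uk\<close> or \<open>sk\<close> with \<open>\<nu> = 1\<close> forces the weight of \<open>e\<^sub>2\<close> to be \<open>k\<close> times that of
  \<open>e\<^sub>1\<close>.\<close>

definition gbr :: "real \<Rightarrow> real \<Rightarrow> real \<Rightarrow> real \<Rightarrow> real \<Rightarrow> real \<Rightarrow> real \<Rightarrow> real \<Rightarrow>
    real^8 \<Rightarrow> real^8 \<Rightarrow> real^8" where
  "gbr \<nu> \<tau> u2 s2 u3 s3 u4 u5 x y = (let p = (\<lambda>i j. x $ i * y $ j - x $ j * y $ i) in
     vec8 0 0 (p 1 2) (p 1 3) (p 1 4 + u2 * p 2 3) (p 1 5 + u2 * p 2 4 + u3 * p 2 3)
       (p 1 6 + (u2 - s2) * p 2 5 + s2 * p 3 4 + u3 * p 2 4 + u4 * p 2 3)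
       (\<nu> * (p 1 7 + (u2 - 2 * s2) * p 2 6 + s2 * p 3 5 + u3 * p 2 5 + u4 * p 2 4)
         + s3 * (p 3 4 - p 2 5) + u5 * p 2 3 + \<tau> * (p 3 6 - p 2 7 - p 4 5)))"

text \<open>The value of \<open>\<tau>\<close> is read off from
  \<open>[e2, e7] = - \<tau> e8\<close>. In the last three algebras the chain stops at
  \<open>e7\<close>, so \<open>\<nu> = 0\<close> and \<open>e8\<close> is reached only through the
  \<open>\<tau>\<close> brackets.\<close>

lemma mu_eq_gbr:
  "mu L_m0 = gbr 1 0 0 0 0 0 0 0"
  "mu L_m1 = gbr 1 (- 1) 0 0 0 0 0 0"
  "mu L_m2 = gbr 1 0 1 0 0 0 0 0"
  "mu (L_g \<alpha>) = gbr 1 0 (2 + \<alpha>) 1 0 0 0 0"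
  "mu (L_a t) = gbr 1 0 0 0 (t + 1) 1 0 0"
  "mu L_c10 = gbr 1 0 0 0 1 0 0 0"
  "mu L_d1 = gbr 1 0 0 0 0 0 1 0"
  "mu L_h1 = gbr 1 0 0 0 0 0 0 1"
  "mu L_b = gbr 0 1 (- 1 / 2) 1 0 0 0 0"
  "mu L_k1 = gbr 0 1 0 0 1 0 0 0"
  "mu L_s1 = gbr 0 1 0 0 0 0 1 0"
  unfolding mu_def atLeastAtMost_1_8
  by (intro ext; simp add: vec_eq_iff forall_8 gbr_def Let_def basis_bracket_def chain_def upt_rec
      eb_def axis_def field_simps)+

lemma gbr_basis:
  "gbr \<nu> \<tau> u2 s2 u3 s3 u4 u5 (eb 1) (eb 2) = eb 3"
  "gbr \<nu> \<tau> u2 s2 u3 s3 u4 u5 (eb 1) (eb 3) = eb 4"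
  "gbr \<nu> \<tau> u2 s2 u3 s3 u4 u5 (eb 1) (eb 4) = eb 5"
  "gbr \<nu> \<tau> u2 s2 u3 s3 u4 u5 (eb 1) (eb 5) = eb 6"
  "gbr \<nu> \<tau> u2 s2 u3 s3 u4 u5 (eb 1) (eb 6) = eb 7"
  "gbr \<nu> \<tau> u2 s2 u3 s3 u4 u5 (eb 1) (eb 7) = \<nu> *\<^sub>R eb 8"
  "gbr \<nu> \<tau> u2 s2 u3 s3 u4 u5 (eb 1) (eb 8) = 0"
  "gbr \<nu> \<tau> u2 s2 u3 s3 u4 u5 (eb 2) (eb 3) = u2 *\<^sub>R eb 5 + u3 *\<^sub>R eb 6 + u4 *\<^sub>R eb 7 + u5 *\<^sub>R eb 8"
  "gbr \<nu> \<tau> u2 s2 u3 s3 u4 u5 (eb 2) (eb 4) = u2 *\<^sub>R eb 6 + u3 *\<^sub>R eb 7 + (\<nu> * u4) *\<^sub>R eb 8"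
  "gbr \<nu> \<tau> u2 s2 u3 s3 u4 u5 (eb 2) (eb 5) = (u2 - s2) *\<^sub>R eb 7 + (\<nu> * u3 - s3) *\<^sub>R eb 8"
  "gbr \<nu> \<tau> u2 s2 u3 s3 u4 u5 (eb 2) (eb 6) = (\<nu> * (u2 - 2 * s2)) *\<^sub>R eb 8"
  "gbr \<nu> \<tau> u2 s2 u3 s3 u4 u5 (eb 2) (eb 7) = - \<tau> *\<^sub>R eb 8"
  "gbr \<nu> \<tau> u2 s2 u3 s3 u4 u5 (eb 2) (eb 8) = 0"
  "gbr \<nu> \<tau> u2 s2 u3 s3 u4 u5 (eb 3) (eb 4) = s2 *\<^sub>R eb 7 + s3 *\<^sub>R eb 8"
  "gbr \<nu> \<tau> u2 s2 u3 s3 u4 u5 (eb 3) (eb 5) = (\<nu> * s2) *\<^sub>R eb 8"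
  "gbr \<nu> \<tau> u2 s2 u3 s3 u4 u5 (eb 3) (eb 6) = \<tau> *\<^sub>R eb 8"
  "gbr \<nu> \<tau> u2 s2 u3 s3 u4 u5 (eb 3) (eb 7) = 0"
  "gbr \<nu> \<tau> u2 s2 u3 s3 u4 u5 (eb 3) (eb 8) = 0"
  "gbr \<nu> \<tau> u2 s2 u3 s3 u4 u5 (eb 4) (eb 5) = - \<tau> *\<^sub>R eb 8"
  "gbr \<nu> \<tau> u2 s2 u3 s3 u4 u5 (eb 4) (eb 6) = 0"
  "gbr \<nu> \<tau> u2 s2 u3 s3 u4 u5 (eb 4) (eb 7) = 0"
  "gbr \<nu> \<tau> u2 s2 u3 s3 u4 u5 (eb 4) (eb 8) = 0"
  "gbr \<nu> \<tau> u2 s2 u3 s3 u4 u5 (eb 5) (eb 6) = 0"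
  "gbr \<nu> \<tau> u2 s2 u3 s3 u4 u5 (eb 5) (eb 7) = 0"
  "gbr \<nu> \<tau> u2 s2 u3 s3 u4 u5 (eb 5) (eb 8) = 0"
  "gbr \<nu> \<tau> u2 s2 u3 s3 u4 u5 (eb 6) (eb 7) = 0"
  "gbr \<nu> \<tau> u2 s2 u3 s3 u4 u5 (eb 6) (eb 8) = 0"
  "gbr \<nu> \<tau> u2 s2 u3 s3 u4 u5 (eb 7) (eb 8) = 0"
  by (simp_all add: vec_eq_iff forall_8 gbr_def Let_def eb_def axis_def algebra_simps)

lemma bilinear_gbr: "bilinear (gbr \<nu> \<tau> u2 s2 u3 s3 u4 u5)"
  unfolding bilinear_def linear_iff
  by (simp add: vec_eq_iff forall_8 gbr_def Let_def algebra_simps)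

lemma gbr_skew: "gbr \<nu> \<tau> u2 s2 u3 s3 u4 u5 x y = - gbr \<nu> \<tau> u2 s2 u3 s3 u4 u5 y x"
  by (simp add: vec_eq_iff forall_8 gbr_def Let_def algebra_simps)

text \<open>Here \<open>a\<close> and \<open>c\<close> are the leading coefficients of \<open>f e\<^sub>1\<close> and \<open>f e\<^sub>2\<close>, and \<open>f e\<^sub>8 = d e\<^sub>8\<close>; each
  relation compares the first coordinate in which the image of a bracket can be nonzero.\<close>

lemma gbr_iso_invariants:
  fixes f :: "real^8 \<Rightarrow> real^8"
  assumes lin: "linear f" and inj: "inj f"
    and hom: "\<And>x y. f (gbr \<nu> \<tau> u2 s2 u3 s3 u4 u5 x y) = gbr \<nu>' \<tau>' u2' s2' u3' s3' u4' u5' (f x) (f y)"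
    and nz: "\<nu> \<noteq> 0 \<or> \<tau> \<noteq> 0"
  obtains a c d where "a \<noteq> 0" "c \<noteq> 0" "d \<noteq> 0"
    "u2 * a^2 = u2' * c" "s2 * a^2 = s2' * c"
    "\<tau>' * (a^5 * c^2) = \<tau> * d"
    "u2 = 0 \<Longrightarrow> u3 * a^3 = u3' * c"
    "u2 = 0 \<Longrightarrow> s2 = 0 \<Longrightarrow> u3 = 0 \<Longrightarrow> u4 * a^4 = u4' * c"
    "\<tau>' = 0 \<Longrightarrow> \<nu> * d = \<nu>' * (a^6 * c)"
    "\<tau>' = 0 \<Longrightarrow> s2 = 0 \<Longrightarrow> s3 * d = s3' * (a^3 * c^2)"
    "\<tau>' = 0 \<Longrightarrow> u2 = 0 \<Longrightarrow> s2 = 0 \<Longrightarrow> u3 = 0 \<Longrightarrow> s3 = 0 \<Longrightarrow> u4 = 0 \<Longrightarrow> u5 * d = u5' * (a * c^2)"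
proof -
  let ?B = "gbr \<nu>' \<tau>' u2' s2' u3' s3' u4' u5'"
  define X Y where "X = f (eb 1)" and "Y = f (eb 2)"
  define E3 E4 E5 E6 E7 E8 where "E3 = f (eb 3)" and "E4 = f (eb 4)" and "E5 = f (eb 5)"
    and "E6 = f (eb 6)" and "E7 = f (eb 7)" and "E8 = f (eb 8)"
  note E_defs = X_def Y_def E3_def E4_def E5_def E6_def E7_def E8_def
  note lins = linear_add[OF lin] linear_scale[OF lin] linear_0[OF lin] linear_diff[OF lin]
  have e3: "E3 = ?B X Y" and e4: "E4 = ?B X E3" and e5: "E5 = ?B X E4" and e6: "E6 = ?B X E5"
    and e7: "E7 = ?B X E6"
    unfolding E_defs hom[symmetric] gbr_basis by simp_all
  have e17: "\<nu> *\<^sub>R E8 = ?B X E7" and e36: "\<tau> *\<^sub>R E8 = ?B E3 E6"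
    and e23: "u2 *\<^sub>R E5 + u3 *\<^sub>R E6 + u4 *\<^sub>R E7 + u5 *\<^sub>R E8 = ?B Y E3"
    and e34: "s2 *\<^sub>R E7 + s3 *\<^sub>R E8 = ?B E3 E4"
    unfolding E_defs hom[symmetric] gbr_basis by (simp_all add: lins)
  note B = gbr_def Let_def
  \<comment> \<open>The determinant of \<open>f\<close> on the quotient by the span of
    \<open>e3, ..., e8\<close>.\<close>
  define \<delta> where "\<delta> = X $ 1 * Y $ 2 - X $ 2 * Y $ 1"
  have c3: "E3 $ 1 = 0" "E3 $ 2 = 0" "E3 $ 3 = \<delta>"
    by (simp_all add: e3 B \<delta>_def)
  have c4: "E4 $ 1 = 0" "E4 $ 2 = 0" "E4 $ 3 = 0" "E4 $ 4 = X $ 1 * \<delta>"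
    by (simp_all add: e4 B c3)
  have c5: "E5 $ 1 = 0" "E5 $ 2 = 0" "E5 $ 3 = 0" "E5 $ 4 = 0" "E5 $ 5 = (X $ 1)^2 * \<delta>"
    by (simp_all add: e5 B c4 power2_eq_square)
  have c6: "E6 $ 1 = 0" "E6 $ 2 = 0" "E6 $ 3 = 0" "E6 $ 4 = 0" "E6 $ 5 = 0" "E6 $ 6 = (X $ 1)^3 * \<delta>"
    by (simp_all add: e6 B c5 power2_eq_square power3_eq_cube)
  have c7: "E7 $ 1 = 0" "E7 $ 2 = 0" "E7 $ 3 = 0" "E7 $ 4 = 0" "E7 $ 5 = 0" "E7 $ 6 = 0"
    "E7 $ 7 = (X $ 1)^4 * \<delta>"
    by (simp_all add: e7 B c6 power_numeral_reduce)
  \<comment> \<open>Both brackets lie on the line of \<open>e8\<close>, and \<open>nz\<close> makes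
    one of the factors of \<open>E8\<close> nonzero, so \<open>E8\<close> lies there as
    well.\<close>
  have "\<forall>i. i \<noteq> 0 \<longrightarrow> (\<nu> *\<^sub>R E8) $ i = 0 \<and> (\<tau> *\<^sub>R E8) $ i = 0"
    unfolding e17 e36 forall_8 by (simp add: B c3 c6 c7)
  then have c8: "E8 $ i = 0" if "i \<noteq> 0" for i
    using that nz by auto
  have ker: "v = 0" if "f v = 0" for v
    using inj lin that by (metis injD linear_0)
  have ebn: "eb 7 $ 7 = 1" "eb 8 $ 7 = 0" "eb 8 $ 0 = 1"
    by (simp_all add: eb_def axis_def)
  have d0: "E8 $ 0 \<noteq> 0"
  proof
    assume "E8 $ 0 = 0"
    then have "E8 = 0" using c8 by (metis vec_eq_iff zero_index)
    then have "eb 8 = 0" using ker by (simp add: E_defs)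
    then show False using ebn(3) by simp
  qed
  \<comment> \<open>Otherwise \<open>E7\<close> and \<open>E8\<close> would both lie on that line,
    against injectivity. Since this coordinate equals \<open>(X $ 1)^4 * \<delta>\<close>, both
    factors are nonzero.\<close>
  have "E7 $ 7 \<noteq> 0"
  proof
    assume *: "E7 $ 7 = 0"
    have "E7 = (E7 $ 0 / E8 $ 0) *\<^sub>R E8"
      using d0 * c7 c8 by (simp add: vec_eq_iff forall_8)
    then have "f (eb 7 - (E7 $ 0 / E8 $ 0) *\<^sub>R eb 8) = 0" by (simp add: lins E_defs)
    then have "eb 7 - (E7 $ 0 / E8 $ 0) *\<^sub>R eb 8 = 0" by (rule ker)
    then have "(eb 7 - (E7 $ 0 / E8 $ 0) *\<^sub>R eb 8) $ 7 = 0" by simp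
    then show False using ebn by simp
  qed
  then have a0: "X $ 1 \<noteq> 0" and \<delta>0: "\<delta> \<noteq> 0" using c7 by auto
  note cs = c3 c4 c5 c6 c7 c8
  \<comment> \<open>This coordinate is \<open>Y $ 1 * \<delta>\<close>, while
    \<open>[e2, e3]\<close> involves only \<open>e5, ..., e8\<close>. So \<open>f e2\<close> has no
    \<open>e1\<close> component and \<open>\<delta> = a * c\<close>.\<close>
  have "(?B Y E3) $ 4 = 0" unfolding e23[symmetric] by (simp add: cs)
  then have y1: "Y $ 1 = 0" using \<delta>0 by (simp add: B cs)
  define a c d where "a = X $ 1" and "c = Y $ 2" and "d = E8 $ 0"
  have \<delta>: "\<delta> = a * c" by (simp add: \<delta>_def y1 a_def c_def)
  have c0: "c \<noteq> 0" using \<delta>0 \<delta> by auto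
  have nz': "a \<noteq> 0" "c \<noteq> 0" "d \<noteq> 0" using a0 c0 d0 by (simp_all add: a_def d_def)
  note cs' = cs y1 a_def[symmetric] c_def[symmetric] d_def[symmetric] \<delta>
  have u2: "u2 * a^2 = u2' * c"
    using arg_cong[OF e23, of "\<lambda>v. v $ 5"] nz' by (simp add: B cs' power2_eq_square algebra_simps)
  have s2: "s2 * a^2 = s2' * c"
    using arg_cong[OF e34, of "\<lambda>v. v $ 7"] nz' by (simp add: B cs' power_numeral_reduce algebra_simps)
  \<comment> \<open>The factors are nonzero, so vanishing passes between the two sides. Once earlier
    constants are gone from both, the next coordinate becomes the leading one.\<close>
  have u2_iff: "u2 = 0 \<longleftrightarrow> u2' = 0" and s2_iff: "s2 = 0 \<longleftrightarrow> s2' = 0"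
    using u2 s2 nz' by auto
  have t: "\<tau>' * (a^5 * c^2) = \<tau> * d"
    using arg_cong[OF e36, of "\<lambda>v. v $ 0"] by (simp add: B cs' power_numeral_reduce algebra_simps)
  then have t_iff: "\<tau> = 0 \<longleftrightarrow> \<tau>' = 0" using nz' by auto
  have u3: "u3 * a^3 = u3' * c" if "u2 = 0"
    using arg_cong[OF e23, of "\<lambda>v. v $ 6"] nz' that u2_iff by (simp add: B cs' power_numeral_reduce algebra_simps)
  then have u3_iff: "u2 = 0 \<Longrightarrow> u3 = 0 \<longleftrightarrow> u3' = 0" using nz' by auto
  have u4: "u4 * a^4 = u4' * c" if "u2 = 0" "s2 = 0" "u3 = 0"
    using arg_cong[OF e23, of "\<lambda>v. v $ 7"] nz' that u2_iff s2_iff u3_iff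
    by (simp add: B cs' power_numeral_reduce algebra_simps)
  then have u4_iff: "u2 = 0 \<Longrightarrow> s2 = 0 \<Longrightarrow> u3 = 0 \<Longrightarrow> u4 = 0 \<longleftrightarrow> u4' = 0" using nz' by auto
  \<comment> \<open>From here on the last coordinate is read, where a nonzero \<open>\<tau>'\<close>
    would bring in uncontrolled entries such as \<open>X $ 2\<close>.\<close>
  have n: "\<nu> * d = \<nu>' * (a^6 * c)" if "\<tau>' = 0"
    using arg_cong[OF e17, of "\<lambda>v. v $ 0"] that by (simp add: B cs' power_numeral_reduce algebra_simps)
  have s3: "s3 * d = s3' * (a^3 * c^2)" if "\<tau>' = 0" "s2 = 0"
    using arg_cong[OF e34, of "\<lambda>v. v $ 0"] that s2_iff
    by (simp add: B cs' power_numeral_reduce algebra_simps)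
  then have s3_iff: "\<tau>' = 0 \<Longrightarrow> s2 = 0 \<Longrightarrow> s3 = 0 \<longleftrightarrow> s3' = 0" using nz' by auto
  have u5: "u5 * d = u5' * (a * c^2)"
    if "\<tau>' = 0" "u2 = 0" "s2 = 0" "u3 = 0" "s3 = 0" "u4 = 0"
    using arg_cong[OF e23, of "\<lambda>v. v $ 0"] that u2_iff s2_iff u3_iff s3_iff u4_iff
    by (simp add: B cs' power_numeral_reduce algebra_simps)
  show ?thesis by (rule that[OF nz' u2 s2 t u3 u4 n s3 u5])
qed

text \<open>Different constructors are told apart by which constants vanish. Within
  \<open>L_g\<close>, \<open>s2 = 1\<close> on both sides forces \<open>c = a^2\<close>, and then
  the values of \<open>u2\<close> agree.\<close>

lemma lie_isomorphic_mu_imp_eq: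
  assumes "lie_isomorphic (mu L) (mu L')"
  shows "L = L'"
proof -
  obtain f where f: "linear f" "inj f" and hom: "\<And>x y. f (mu L x y) = mu L' (f x) (f y)"
    using assms unfolding lie_isomorphic_def bij_def by blast
  \<comment> \<open>This serves \<open>L_a\<close>: \<open>\<nu> = 1\<close> gives
    \<open>d = a^6 * c\<close> and \<open>s3 = 1\<close> gives \<open>d = a^3 * c^2\<close>. With
    \<open>c = a^3\<close>, the relation for \<open>u3\<close> equates the parameters.\<close>
  have cube: "c = a^3" if "a^6 * c = a^3 * c^2" "a \<noteq> 0" "c \<noteq> 0" for a c :: real
  proof -
    have "(a^3 * c) * (a^3 - c) = 0" using that(1) by (simp add: power_numeral_reduce algebra_simps)
    then show ?thesis using that by simp
  qed
  show ?thesis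
    by (insert hom, cases L; cases L'; simp add: mu_eq_gbr; (elim gbr_iso_invariants[OF f]; simp; (drule cube; simp)?))
qed

subsection \<open>The lower central series and gradings\<close>

context real_lie_algebra
begin

abbreviation "D \<equiv> lower_central br"

lemma subspace_lower_central: "subspace (D k)"
  by (cases k) simp_all

lemmas br_simps = bilinear_ladd[OF bilinear] bilinear_radd[OF bilinear] bilinear_lmul[OF bilinear]
  bilinear_rmul[OF bilinear] bilinear_lneg[OF bilinear] bilinear_rneg[OF bilinear]
  bilinear_lzero[OF bilinear] bilinear_rzero[OF bilinear] bilinear_lsub[OF bilinear]
  bilinear_rsub[OF bilinear]

lemma br_self: "br x x = 0"
  using skew[of x x] by (simp add: eq_neg_iff_add_eq_0 flip: scaleR_2)

lemma br_leibniz: "br x (br y z) = br (br x y) z + br y (br x z)"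
proof -
  have "br x (br y z) = - br y (br z x) - br z (br x y)"
    using jacobi[of x y z] by (simp add: eq_neg_iff_add_eq_0 algebra_simps)
  then show ?thesis using skew[of z x] skew[of z "br x y"] by (simp add: br_simps)
qed

lemmas lower_central_Suc = lower_central.simps(2)[of br]

declare lower_central.simps(2) [simp del]

lemmas D_simps = subspace_add[OF subspace_lower_central] subspace_diff[OF subspace_lower_central]
  subspace_scale[OF subspace_lower_central] subspace_0[OF subspace_lower_central]
  subspace_neg[OF subspace_lower_central]

lemma br_D: "y \<in> D k \<Longrightarrow> br x y \<in> D (Suc k)"
  unfolding lower_central_Suc by (auto intro: span_base)

lemma br_D': "x \<in> D k \<Longrightarrow> br x y \<in> D (Suc k)"
  by (metis skew br_D D_simps(5))

lemma D_Suc_subset: "D (Suc k) \<subseteq> D k"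
proof (induction k)
  case (Suc k)
  have "{br x y |x y. y \<in> D (Suc k)} \<subseteq> D (Suc k)"
    using Suc br_D by blast
  then have "span {br x y |x y. y \<in> D (Suc k)} \<subseteq> D (Suc k)"
    using span_minimal subspace_lower_central by blast
  then show ?case by (subst lower_central_Suc)
qed simp

lemma D_antimono: "i \<le> j \<Longrightarrow> D j \<subseteq> D i"
  by (induction rule: dec_induct) (use D_Suc_subset in auto)

text \<open>The \<open>+ 1\<close> comes from \<open>D 0 = UNIV\<close>. For
  \<open>x = [a, b]\<close>, Leibniz writes \<open>[x, y]\<close> as
  \<open>[a, [b, y]] - [b, [a, y]]\<close>, and the induction hypothesis for \<open>b\<close>
  handles both terms.\<close>

lemma br_D_D: "x \<in> D i \<Longrightarrow> y \<in> D j \<Longrightarrow> br x y \<in> D (i + j + 1)"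
proof (induction i arbitrary: x y j)
  case 0
  then show ?case using br_D by simp
next
  case (Suc i)
  have sub: "subspace {x. br x y \<in> D (Suc i + j + 1)}"
    using D_simps by (auto simp: subspace_def br_simps)
  have "x \<in> span {br a b |a b. b \<in> D i}" using Suc.prems by (simp add: lower_central_Suc)
  then have "x \<in> {x. br x y \<in> D (Suc i + j + 1)}"
  proof (induction rule: span_induct)
    case base
    then show ?case using sub by simp
  next
    case (step x)
    then obtain a b where x: "x = br a b" and b: "b \<in> D i" by blast
    have "br a (br b y) \<in> D (Suc (i + j + 1))" using br_D Suc.IH[OF b Suc.prems(2)] by blast
    moreover have "br b (br a y) \<in> D (i + Suc j + 1)" using Suc.IH[OF b br_D[OF Suc.prems(2)]] .
    moreover have "br x y = br a (br b y) - br b (br a y)" unfolding x using br_leibniz[of a b y] by simp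
    ultimately show ?case using D_simps(2) by simp
  qed
  then show ?case by simp
qed

lemma mem_D: "x \<in> D i \<Longrightarrow> y \<in> D j \<Longrightarrow> k \<le> i + j + 1 \<Longrightarrow> br x y \<in> D k"
  using br_D_D D_antimono by blast

lemma D_eq_imp_const: "D k \<subseteq> D (Suc k) \<Longrightarrow> D k \<subseteq> D (k + m)"
proof (induction m)
  case (Suc m)
  have eq: "D (Suc k) = D k" using Suc.prems D_Suc_subset by blast
  have "D (k + m) = D k" using Suc D_antimono[of k "k + m"] by auto
  then have "D (k + Suc m) = D (Suc k)" unfolding add_Suc_right lower_central_Suc by (rule arg_cong)
  then show ?case using eq by simp
qed simp

text \<open>Modulo \<open>D (Suc (Suc k))\<close>, a bracket \<open>[a, b]\<close> with
  \<open>b\<close> in \<open>D k\<close> depends only on \<open>a\<close> modulo \<open>D 1\<close>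
  and \<open>b\<close> modulo \<open>D (Suc k)\<close>. So where the series still drops,
  \<open>[x, v]\<close> or \<open>[y, v]\<close> must survive.\<close>

lemma D_Suc_generated:
  assumes gen: "\<And>z. \<exists>s t. z - s *\<^sub>R x - t *\<^sub>R y \<in> D 1"
    and v: "v \<in> D k" and Dk: "\<And>z. z \<in> D k \<Longrightarrow> \<exists>s. z - s *\<^sub>R v \<in> D (Suc k)"
    and xy: "br x v \<in> D (Suc (Suc k))" "br y v \<in> D (Suc (Suc k))"
  shows "D (Suc k) \<subseteq> D (Suc (Suc k))"
proof -
  have "br a b \<in> D (Suc (Suc k))" if "b \<in> D k" for a b
  proof -
    obtain s t where st: "a - s *\<^sub>R x - t *\<^sub>R y \<in> D 1" (is "?a \<in> _") using gen by blast
    obtain r where r: "b - r *\<^sub>R v \<in> D (Suc k)" using Dk[OF \<open>b \<in> D k\<close>] by blast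
    have "br a b = br a (b - r *\<^sub>R v) + r *\<^sub>R (br ?a v + s *\<^sub>R br x v + t *\<^sub>R br y v)"
      by (simp add: br_simps algebra_simps)
    moreover have "br ?a v \<in> D (Suc (Suc k))" using mem_D[OF st v] by simp
    ultimately show ?thesis using br_D[OF r, of a] xy D_simps by simp
  qed
  then have "{br a b |a b. b \<in> D k} \<subseteq> D (Suc (Suc k))" by auto
  then have "span {br a b |a b. b \<in> D k} \<subseteq> D (Suc (Suc k))"
    using span_minimal subspace_lower_central by blast
  then show ?thesis unfolding lower_central_Suc[of k] .
qed

text \<open>Modulo \<open>D 2\<close> the bracket is an alternating map on the quotient by
  \<open>D 1\<close>, and such a map on a line is zero. This is why a filiform algebra needs two
  generators.\<close>

lemma one_generator_abelianization:
  assumes "span (insert x (D 1)) = UNIV"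
  shows "D 1 \<subseteq> D 2"
proof -
  have "br a b \<in> D 2" for a b
  proof -
    obtain s t where st: "a - s *\<^sub>R x \<in> D 1" "b - t *\<^sub>R x \<in> D 1"
      using assms span_breakdown_eq[of _ x "D 1"] span_eq_iff[THEN iffD2, OF subspace_lower_central, of 1]
      by (metis UNIV_I)
    have "br a b = br (a - s *\<^sub>R x) b + s *\<^sub>R br x (b - t *\<^sub>R x)"
      by (simp add: br_simps br_self algebra_simps)
    moreover have "br (a - s *\<^sub>R x) b \<in> D 2" "br x (b - t *\<^sub>R x) \<in> D 2"
      using br_D[OF st(2)] br_D'[OF st(1)] by (simp_all add: numeral_2_eq_2)
    ultimately show ?thesis using D_simps by simp
  qed
  then have "{br a b |a b. b \<in> D 0} \<subseteq> D 2" by auto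
  then have "span {br a b |a b. b \<in> D 0} \<subseteq> D 2"
    using span_minimal subspace_lower_central by blast
  then show ?thesis by (simp add: lower_central_Suc)
qed

text \<open>There are \<open>n - 1\<close> strict drops, and the first is at least two because one
  generator does not suffice. As they add up to \<open>n\<close>, the first is exactly two and every
  other is one.\<close>

lemma filiform_lower_central:
  assumes dim: "dim (UNIV :: 'a set) = n" and n: "n \<ge> 3" and fil: "filiform br"
  shows filiform_D_end: "D (n - 1) = {0}"
    and filiform_D_strict: "k < n - 1 \<Longrightarrow> \<not> D k \<subseteq> D (Suc k)"
    and filiform_D_insert: "1 \<le> k \<Longrightarrow> v \<in> D k \<Longrightarrow> v \<notin> D (Suc k) \<Longrightarrow> z \<in> D k \<Longrightarrow>
      \<exists>s. z - s *\<^sub>R v \<in> D (Suc k)"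
    and filiform_generators: "x \<notin> D 1 \<Longrightarrow> y \<notin> span (insert x (D 1)) \<Longrightarrow>
      \<exists>s t. z - s *\<^sub>R x - t *\<^sub>R y \<in> D 1"
    and filiform_span_insert: "span (insert x (D 1)) \<noteq> UNIV"
proof -
  show D0: "D (n - 1) = {0}"
    using fil dim by (simp add: filiform_def step_nilpotent_def)
  show strict: "\<not> D k \<subseteq> D (Suc k)" if "k < n - 1" for k
  proof
    assume "D k \<subseteq> D (Suc k)"
    then have "D k \<subseteq> D (k + (n - 1 - k))" by (rule D_eq_imp_const)
    then have "D k \<subseteq> {0}" using D0 that by simp
    then have "D k = {0}" using D_simps(4)[of k] by blast
    then show False using fil dim that by (simp add: filiform_def step_nilpotent_def)
  qed
  show ins: "span (insert x (D 1)) \<noteq> UNIV" for x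
    using one_generator_abelianization[of x] strict[of 1] n by (auto simp: numeral_2_eq_2)
  \<comment> \<open>An infinite basis would have \<open>card\<close> equal to 0, so
    \<open>n \<ge> 3\<close> yields finite dimension.\<close>
  obtain Bs :: "'a set" where Bs: "independent Bs" "span Bs = UNIV" "card Bs = n"
    using basis_exists[of "UNIV :: 'a set"] dim by (metis subset_UNIV subset_antisym)
  then have "finite Bs" using n card.infinite by fastforce
  then interpret fd: finite_dimensional_vector_space "scaleR :: real \<Rightarrow> 'a \<Rightarrow> 'a" Bs
    rewrites "module.dependent (*\<^sub>R) = (dependent :: 'a set \<Rightarrow> _)"
      and "module.subspace (*\<^sub>R) = (subspace :: 'a set \<Rightarrow> _)"
      and "module.span (*\<^sub>R) = (span :: 'a set \<Rightarrow> _)"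
      and "vector_space.dim (*\<^sub>R) = (dim :: 'a set \<Rightarrow> _)"
    using Bs by unfold_locales
      (auto simp: dependent_raw_def subspace_raw_def span_raw_def dim_raw_def)
  have sp: "span (D k) = D k" for k using subspace_lower_central span_eq_iff by blast
  have drop: "dim (D (Suc k)) < dim (D k)" if "k < n - 1" for k
    using fd.dim_psubset[of "D (Suc k)" "D k"] strict[OF that] D_Suc_subset[of k] sp by auto
  \<comment> \<open>Counting drops up from \<open>D (n - 1)\<close> gives this lower bound;
    \<open>le\<close> counts them down from \<open>D 1\<close> and reaches the same number as an
    upper bound.\<close>
  have ge: "n - 1 - k \<le> dim (D k)" if "k \<le> n - 1" for k
    using that
  proof (induction rule: inc_induct)
    case (step m)
    then show ?case using drop[of m]  by linarith
  qed simp
  have two: "dim (insert y (insert x (D 1))) = dim (D 1) + 2"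
    if "x \<notin> D 1" "y \<notin> span (insert x (D 1))" for x y
    using that by (simp add: fd.dim_insert sp del: One_nat_def)
  obtain x where x: "x \<notin> D 1" using strict[of 0] n by auto
  obtain y where y: "y \<notin> span (insert x (D 1))" using ins by blast
  have D1: "dim (D 1) \<le> n - 2"
    using two[OF x y] fd.dim_subset[of "insert y (insert x (D 1))" UNIV] dim by simp
  have le: "dim (D k) \<le> n - 1 - k" if "1 \<le> k" "k \<le> n - 1" for k
    using that
  proof (induction rule: dec_induct)
    case base
    then show ?case using D1 by simp
  next
    case (step m)
    then show ?case using drop[of m] by linarith
  qed
  show "\<exists>s t. z - s *\<^sub>R x - t *\<^sub>R y \<in> D 1" if "x \<notin> D 1" "y \<notin> span (insert x (D 1))" for x y z
  proof -
    have "dim (UNIV :: 'a set) \<le> dim (insert y (insert x (D 1)))"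
      using two[OF that] ge[of 1] n dim by linarith
    then have "span (insert y (insert x (D 1))) = span UNIV"
      using fd.dim_eq_span[of "insert y (insert x (D 1))" UNIV] by blast
    then have "z \<in> span (insert y (insert x (D 1)))" by simp
    then show ?thesis unfolding span_breakdown_eq sp
      by (metis diff_diff_eq add.commute)
  qed
  show "\<exists>s. z - s *\<^sub>R v \<in> D (Suc k)" if k: "1 \<le> k" and "v \<in> D k" "v \<notin> D (Suc k)" "z \<in> D k" for k v z
  proof -
    have "D (n - 1) \<subseteq> D (Suc k)" using D0 D_simps(4) by simp
    then have kn: "k < n - 1"
      using that D_antimono[of "n - 1" k] D0 D_simps(4)[of "Suc k"] by (metis not_less singletonD subsetD)
    have "dim (insert v (D (Suc k))) = dim (D (Suc k)) + 1"
      using that by (simp add: fd.dim_insert sp)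
    then have "dim (D k) \<le> dim (insert v (D (Suc k)))"
      using le[of k] ge[of "Suc k"] k kn by simp
    then have "span (insert v (D (Suc k))) = span (D k)"
      using that D_Suc_subset[of k] by (intro fd.dim_eq_span) auto
    then have "z \<in> span (insert v (D (Suc k)))" using that sp by simp
    then show ?thesis unfolding span_breakdown_eq sp .
  qed
qed

end

text \<open>On homogeneous vectors the Leibniz rule holds because degrees add, and bilinearity
  extends it. Indices starting at 1 make the eigenvalues positive.\<close>

lemma N_graded_imp_derivation:
  fixes br :: "'a::real_vector \<Rightarrow> 'a \<Rightarrow> 'a"
  assumes lie: "real_lie_algebra br" and gr: "N_graded br"
  obtains T where "linear T" "\<And>x y. T (br x y) = br (T x) y + br x (T y)"
    "span {x. \<exists>w>0. T x = w *\<^sub>R x} = UNIV"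
proof -
  interpret real_lie_algebra br by fact
  obtain r :: nat and V :: "nat \<Rightarrow> 'a set" where "\<forall>i\<ge>1. subspace (V i)" and "\<forall>k>r. V k = {0}"
    and ex: "\<forall>x. \<exists>!v. v \<in> (\<Pi>\<^sub>E i\<in>{1..r}. V i) \<and> x = (\<Sum>i=1..r. v i)"
    and "\<forall>i\<ge>1. \<forall>j\<ge>1. \<forall>x\<in>V i. \<forall>y\<in>V j. br x y \<in> V (i + j)"
    using gr unfolding N_graded_def by (elim exE conjE) (rule that, assumption+)
  then have sub: "\<And>i. i \<ge> 1 \<Longrightarrow> subspace (V i)" and V0: "\<And>k. k > r \<Longrightarrow> V k = {0}"
    and brV: "\<And>i j x y. i \<ge> 1 \<Longrightarrow> j \<ge> 1 \<Longrightarrow> x \<in> V i \<Longrightarrow> y \<in> V j \<Longrightarrow> br x y \<in> V (i + j)"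
    by simp_all
  note ex1 = spec[OF ex]
  define c where "c x = (THE v. v \<in> (\<Pi>\<^sub>E i\<in>{1..r}. V i) \<and> x = (\<Sum>i=1..r. v i))" for x
  have c': "c x \<in> (\<Pi>\<^sub>E i\<in>{1..r}. V i) \<and> x = (\<Sum>i=1..r. c x i)" for x
    unfolding c_def by (rule theI'[OF ex1])
  note c = conjunct1[OF c'] conjunct2[OF c']
  have cV: "c x i \<in> V i" if "i \<in> {1..r}" for x i using c(1)[of x] that by (auto simp: PiE_iff)
  have c_eq: "c x i = v i" if "\<And>i. i \<in> {1..r} \<Longrightarrow> v i \<in> V i" "x = (\<Sum>i=1..r. v i)" "i \<in> {1..r}" for x v i
  proof -
    \<comment> \<open>Families in \<open>\<Pi>\<^sub>E\<close> are \<open>undefined\<close> outside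
      \<open>{1..r}\<close>, so \<open>v\<close> is restricted before uniqueness applies.\<close>
    have "restrict v {1..r} \<in> (\<Pi>\<^sub>E i\<in>{1..r}. V i)" using that(1) by (rule restrict_PiE_iff[THEN iffD2, OF ballI])
    moreover have "x = (\<Sum>i=1..r. restrict v {1..r} i)" using that(2) by simp
    ultimately have "c x = restrict v {1..r}" unfolding c_def by (intro the1_equality ex1 conjI)
    then show ?thesis using that(3) by simp
  qed
  \<comment> \<open>\<open>T\<close> is multiplication by \<open>i\<close> on \<open>V i\<close>.\<close>
  define T where "T x = (\<Sum>i=1..r. real i *\<^sub>R c x i)" for x
  have lin: "linear T"
  proof (rule linearI)
    fix x y
    have "c (x + y) i = c x i + c y i" if "i \<in> {1..r}" for i
    proof (rule c_eq[OF _ _ that])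
      show "x + y = (\<Sum>i=1..r. c x i + c y i)" unfolding sum.distrib c(2)[symmetric] ..
    qed (use cV sub in \<open>auto simp: subspace_add\<close>)
    then show "T (x + y) = T x + T y"
      by (simp add: T_def sum.distrib[symmetric] scaleR_add_right)
  next
    fix a x
    have "c (a *\<^sub>R x) i = a *\<^sub>R c x i" if "i \<in> {1..r}" for i
    proof (rule c_eq[OF _ _ that])
      show "a *\<^sub>R x = (\<Sum>i=1..r. a *\<^sub>R c x i)" unfolding scaleR_sum_right[symmetric] c(2)[symmetric] ..
    qed (use cV sub in \<open>auto simp: subspace_scale\<close>)
    then show "T (a *\<^sub>R x) = a *\<^sub>R T x"
      by (simp add: T_def scaleR_sum_right mult.commute)
  qed
  \<comment> \<open>Indices beyond \<open>r\<close> are covered because a bracket of homogeneous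
    vectors may land there.\<close>
  have TV: "T x = real k *\<^sub>R x" if "k \<ge> 1" "x \<in> V k" for x k
  proof (cases "k \<le> r")
    case True
    then have k: "k \<in> {1..r}" using that by simp
    have "c x i = (if i = k then x else 0)" if "i \<in> {1..r}" for i
      using that k \<open>x \<in> V k\<close> sub by (intro c_eq) (auto simp: subspace_0)
    then have "T x = (\<Sum>i=1..r. if i = k then real k *\<^sub>R x else 0)"
      unfolding T_def by (intro sum.cong) auto
    then show ?thesis using k by simp
  next
    case False
    then show ?thesis using V0[of k] that linear_0[OF lin] by simp
  qed
  define E where "E = {x. \<exists>w>0. T x = w *\<^sub>R x}"
  have VE: "x \<in> E" if "k \<ge> 1" "x \<in> V k" for x k
    unfolding E_def using TV[OF that] that(1) by (intro CollectI exI[of _ "real k"]) simp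
  have span: "span (\<Union>k\<in>{1..r}. V k) = UNIV"
  proof -
    have "x \<in> span (\<Union>k\<in>{1..r}. V k)" for x
      by (subst c(2)[of x]) (intro span_sum span_base, use cV in blast)
    then show ?thesis by blast
  qed
  have "T (br x y) = br (T x) y + br x (T y)" for x y
  proof -
    have bl: "bilinear (\<lambda>x y. T (br x y))"
      unfolding bilinear_def using lin by (auto simp: linear_iff br_simps)
    have br': "bilinear (\<lambda>x y. br (T x) y + br x (T y))"
      unfolding bilinear_def using lin by (auto simp: linear_iff br_simps algebra_simps)
    have "(\<lambda>x y. T (br x y)) x y = (\<lambda>x y. br (T x) y + br x (T y)) x y"
    proof (rule bilinear_eq[OF bl br', of UNIV "\<Union>k\<in>{1..r}. V k" UNIV "\<Union>k\<in>{1..r}. V k"])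
      fix x y assume "x \<in> (\<Union>k\<in>{1..r}. V k)" "y \<in> (\<Union>k\<in>{1..r}. V k)"
      then obtain i j where ij: "i \<ge> 1" "j \<ge> 1" "x \<in> V i" "y \<in> V j" by auto
      show "T (br x y) = br (T x) y + br x (T y)"
        using TV[OF _ brV[OF ij]] TV[OF ij(1,3)] TV[OF ij(2,4)] ij
        by (simp add: br_simps scaleR_add_left)
    qed (use span in auto)
    then show ?thesis .
  qed
  moreover have "span E = UNIV"
    using span span_mono[of "\<Union>k\<in>{1..r}. V k" E] VE by fastforce
  ultimately show ?thesis using that lin unfolding E_def by blast
qed

subsection \<open>Homogeneous bases\<close>

lemma subspace_scale_cancel: "subspace S \<Longrightarrow> c *\<^sub>R v \<in> S \<Longrightarrow> c \<noteq> 0 \<Longrightarrow> v \<in> S"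
  using subspace_scale[of S "c *\<^sub>R v" "inverse c"] by simp

context real_lie_algebra
begin

lemma derivation_D:
  assumes T: "linear T" "\<And>x y. T (br x y) = br (T x) y + br x (T y)"
  shows "x \<in> D k \<Longrightarrow> T x \<in> D k"
proof (induction k arbitrary: x)
  case (Suc k)
  have sub: "subspace {x. T x \<in> D (Suc k)}"
    using D_simps T(1) by (auto simp: subspace_def linear_iff linear_0)
  have "{br a b |a b. b \<in> D k} \<subseteq> {x. T x \<in> D (Suc k)}"
    using T(2) D_simps(1) br_D Suc.IH by auto
  then have "span {br a b |a b. b \<in> D k} \<subseteq> {x. T x \<in> D (Suc k)}"
    using sub by (rule span_minimal)
  then show ?case using Suc.prems by (auto simp: lower_central_Suc)
qed simp

text \<open>If the weights differ, \<open>[x, [x, y]]\<close> and \<open>[y, [x, y]]\<close> are eigenvectors for distinct eigenvalues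
  that are dependent modulo \<open>D 3\<close>, so one of them lies in \<open>D 3\<close>; if they agree, every combination
  of \<open>x\<close> and \<open>y\<close> is again homogeneous.\<close>

lemma homogeneous_generators:
  assumes dim: "dim (UNIV :: 'a set) = n" and n: "n \<ge> 4" and fil: "filiform br"
    and T: "linear T" "\<And>x y. T (br x y) = br (T x) y + br x (T y)"
    and sp: "span {x. \<exists>w>0. T x = w *\<^sub>R x} = UNIV"
  obtains x y p q where "p > 0" "q > 0" "T x = p *\<^sub>R x" "T y = q *\<^sub>R y"
    "\<And>z. \<exists>s t. z - s *\<^sub>R x - t *\<^sub>R y \<in> D 1" "br y (br x y) \<in> D 3"
proof -
  note result = that
  have n3: "n \<ge> 3" using n by simp
  note fl = filiform_lower_central[OF dim n3 fil]
  note Tl = linear_add[OF T(1)] linear_scale[OF T(1)] linear_diff[OF T(1)]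
  \<comment> \<open>Eigenvectors span, so every proper subspace misses one.\<close>
  have ex: "\<exists>x p. p > 0 \<and> T x = p *\<^sub>R x \<and> x \<notin> S" if "subspace S" "S \<noteq> UNIV" for S
    using span_minimal[of "{x. \<exists>w>0. T x = w *\<^sub>R x}" S] that sp by blast
  have "D 1 \<noteq> UNIV" using fl(2)[of 0] n by auto
  then obtain x p where x: "p > 0" "T x = p *\<^sub>R x" "x \<notin> D 1"
    using ex subspace_lower_central by blast
  obtain y q where y: "q > 0" "T y = q *\<^sub>R y" "y \<notin> span (insert x (D 1))"
    using ex[OF subspace_span fl(5)[of x]] by (elim exE conjE)
  note gen = fl(4)[OF x(3) y(3)]
  define z where "z = br x y"
  have z: "z \<in> D 1" using br_D[of y 0 x] by (simp add: z_def)
  have xz: "br x z \<in> D 2" "br y z \<in> D 2" using br_D[OF z] by (simp_all add: numeral_2_eq_2)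
  have Txz: "T (br x z) = (p + p + q) *\<^sub>R br x z" "T (br y z) = (p + q + q) *\<^sub>R br y z"
    by (simp_all only: z_def T(2) x y br_simps scaleR_add_left scaleR_add_right ac_simps)
  have swap: thesis if "br x z \<in> D 3"
  proof (rule result[of q p y x])
    show "\<exists>s t. w - s *\<^sub>R y - t *\<^sub>R x \<in> D 1" for w
    proof -
      obtain s t where "w - s *\<^sub>R x - t *\<^sub>R y \<in> D 1" using gen by blast
      then have "w - t *\<^sub>R y - s *\<^sub>R x \<in> D 1" by (simp add: algebra_simps)
      then show ?thesis by blast
    qed
    have "br x (br y x) = - br x z" using skew[of y x] by (simp add: z_def br_simps)
    then show "br x (br y x) \<in> D 3" using \<open>br x z \<in> D 3\<close> D_simps(5) by simp
  qed (use x y in auto)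
  show thesis
  proof (cases "br x z \<in> D 3")
    case False
    have "\<exists>s. br y z - s *\<^sub>R br x z \<in> D (Suc 2)"
      by (rule fl(3)) (use xz False in \<open>simp_all add: numeral_2_eq_2 numeral_3_eq_3\<close>)
    then obtain s where s: "br y z - s *\<^sub>R br x z \<in> D 3" by (auto simp: numeral_3_eq_3 numeral_2_eq_2)
    show thesis
    proof (cases "p = q \<or> s = 0")
      case True
      \<comment> \<open>Replacing \<open>y\<close> by \<open>y - s x\<close> turns
        \<open>[y, z]\<close> into \<open>[y, z] - s [x, z]\<close>. The new vector is homogeneous
        because \<open>p = q\<close>, or because \<open>s = 0\<close> changes nothing.\<close>
      show thesis
      proof (rule result[of p q x "y - s *\<^sub>R x"])
        show "T (y - s *\<^sub>R x) = q *\<^sub>R (y - s *\<^sub>R x)"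
          using True x y by (auto simp: Tl algebra_simps)
        show "\<exists>a b. w - a *\<^sub>R x - b *\<^sub>R (y - s *\<^sub>R x) \<in> D 1" for w
        proof -
          obtain a b where "w - a *\<^sub>R x - b *\<^sub>R y \<in> D 1" using gen by blast
          moreover have "w - (a + b * s) *\<^sub>R x - b *\<^sub>R (y - s *\<^sub>R x) = w - a *\<^sub>R x - b *\<^sub>R y"
            by (simp add: algebra_simps)
          ultimately have "w - (a + b * s) *\<^sub>R x - b *\<^sub>R (y - s *\<^sub>R x) \<in> D 1" by (simp only:)
          then show ?thesis by blast
        qed
        show "br (y - s *\<^sub>R x) (br x (y - s *\<^sub>R x)) \<in> D 3"
          using s by (simp add: br_simps br_self z_def)
      qed (use x y in auto)
    next
      case neq: False
      \<comment> \<open>\<open>T - (p + 2 q)\<close> preserves \<open>D 3\<close> and annihilates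
        \<open>[y, z]\<close>, which leaves a nonzero multiple of \<open>[x, z]\<close>.\<close>
      have "T (br y z - s *\<^sub>R br x z) - (p + q + q) *\<^sub>R (br y z - s *\<^sub>R br x z) \<in> D 3"
        using derivation_D[OF T s] s D_simps by blast
      also have "T (br y z - s *\<^sub>R br x z) - (p + q + q) *\<^sub>R (br y z - s *\<^sub>R br x z)
          = (s * (p + q + q) - s * (p + p + q)) *\<^sub>R br x z"
        by (simp add: Tl Txz scaleR_diff_right scaleR_diff_left mult.commute)
      also have "s * (p + q + q) - s * (p + p + q) = s * (q - p)"
        by (simp add: algebra_simps)
      finally have "br x z \<in> D 3"
        by (rule subspace_scale_cancel[OF subspace_lower_central]) (use neq in simp)
      then show thesis by (rule swap)
    qed
  qed (rule swap)
qed

text \<open>While \<open>e2\<close> sends the current vector one term deeper than it must, its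
  bracket with \<open>e1\<close> has to span the next quotient. Leibniz propagates this depth from
  \<open>[e2, e3]\<close>, the obstacle being \<open>[e3, e4]\<close>. It gives no such bound for
  \<open>[e2, e7]\<close>, hence the final disjunction.\<close>

lemma filiform8_chain:
  assumes dim: "dim (UNIV :: 'a set) = 8" and fil: "filiform br"
    and gen: "\<And>z. \<exists>s t. z - s *\<^sub>R e1 - t *\<^sub>R e2 \<in> D 1" and e23: "br e2 (br e1 e2) \<in> D 3"
    and e: "e3 = br e1 e2" "e4 = br e1 e3" "e5 = br e1 e4" "e6 = br e1 e5" "e7 = br e1 e6"
  shows "e3 \<in> D 1" "e3 \<notin> D 2" "e4 \<in> D 2" "e4 \<notin> D 3" "e5 \<in> D 3" "e5 \<notin> D 4"
    "e6 \<in> D 4" "e6 \<notin> D 5" "e7 \<in> D 5" "e7 \<notin> D 6" "br e3 e4 \<in> D 5"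
    "br e1 e7 \<noteq> 0 \<or> br e2 e7 \<noteq> 0"
proof -
  note fl = filiform_lower_central[OF dim _ fil, simplified]
  have br1: "br a b \<in> D 1" for a b using mem_D[of a 0 b 0 1] by simp
  show e3: "e3 \<in> D 1" unfolding e by (rule br1)
  show e4: "e4 \<in> D 2" unfolding e(2) by (rule mem_D[of _ 0 _ 1]) (use e3 in auto)
  show e5: "e5 \<in> D 3" unfolding e(3) by (rule mem_D[of _ 0 _ 2]) (use e4 in auto)
  show e6: "e6 \<in> D 4" unfolding e(4) by (rule mem_D[of _ 0 _ 3]) (use e5 in auto)
  show e7: "e7 \<in> D 5" unfolding e(5) by (rule mem_D[of _ 0 _ 4]) (use e6 in auto)
  have G: "br e1 v \<notin> D (k + 2)" if "v \<in> D k" "v \<notin> D (Suc k)" "1 \<le> k" "k < 6" "br e2 v \<in> D (k + 2)" for v k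
  proof
    assume "br e1 v \<in> D (k + 2)"
    then have "D (Suc k) \<subseteq> D (Suc (Suc k))"
      using that fl(3)[of k v] by (intro D_Suc_generated[OF gen that(1)]) simp_all
    then show False using fl(2)[of "Suc k"] that by simp
  qed
  have zero: "br e1 v \<noteq> 0" if "v \<in> D 5" "v \<notin> D 6" "br e2 v = 0" for v
    using G[of v 5] that D_simps(4)[of 7] by auto
  \<comment> \<open>\<open>G\<close> does not cover \<open>k = 0\<close>, where the quotient is
    two-dimensional. There \<open>[e1, e2]\<close> alone spans all brackets modulo
    \<open>D 2\<close>.\<close>
  show "e3 \<notin> D 2"
  proof
    assume "e3 \<in> D 2"
    then have e12: "br e1 e2 \<in> D 2" and e21: "br e2 e1 \<in> D 2"
      unfolding e using skew[of e2 e1] D_simps(5) by simp_all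
    have "br a b \<in> D 2" for a b
    proof -
      obtain s t where st: "a - s *\<^sub>R e1 - t *\<^sub>R e2 \<in> D 1" using gen by blast
      obtain s' t' where st': "b - s' *\<^sub>R e1 - t' *\<^sub>R e2 \<in> D 1" using gen by blast
      have "br a b = br (a - s *\<^sub>R e1 - t *\<^sub>R e2) b
        + s *\<^sub>R (br e1 (b - s' *\<^sub>R e1 - t' *\<^sub>R e2) + t' *\<^sub>R br e1 e2)
        + t *\<^sub>R (br e2 (b - s' *\<^sub>R e1 - t' *\<^sub>R e2) + s' *\<^sub>R br e2 e1)"
        by (simp add: br_simps br_self algebra_simps)
      moreover have "br (a - s *\<^sub>R e1 - t *\<^sub>R e2) b \<in> D 2"
        by (rule mem_D[OF st, of _ 0]) simp_all
      moreover have "br c (b - s' *\<^sub>R e1 - t' *\<^sub>R e2) \<in> D 2" for c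
        by (rule mem_D[OF _ st', of _ 0]) simp_all
      ultimately show ?thesis using e12 e21 D_simps by simp
    qed
    then have "{br a b |a b. b \<in> D 0} \<subseteq> D 2" by auto
    then have "span {br a b |a b. b \<in> D 0} \<subseteq> D 2"
      using subspace_lower_central by (rule span_minimal)
    then have "D 1 \<subseteq> D 2" by (simp add: lower_central_Suc)
    then show False using fl(2)[of 1] by (simp add: numeral_2_eq_2)
  qed
  then show e4': "e4 \<notin> D 3"
    using G[OF e3] e23 e by (simp add: numeral_2_eq_2 numeral_3_eq_3)
  have e24_eq: "br e2 e4 = br e1 (br e2 e3)"
    using br_leibniz[of e1 e2 e3] by (simp add: br_self flip: e)
  have e24: "br e2 e4 \<in> D 4"
    unfolding e24_eq by (rule mem_D[of _ 0 _ 3]) (use e23 e in auto)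
  show e5': "e5 \<notin> D 4"
    using G[OF e4] e4' e24 e by simp
  have w4: "br e3 e4 \<in> D 4" by (rule mem_D[OF e3 e4]) simp
  have e34_25: "br e1 (br e2 e4) = br e3 e4 + br e2 e5"
    using br_leibniz[of e1 e2 e4] by (simp flip: e)
  have d5: "br e1 (br e2 e4) \<in> D 5" by (rule mem_D[OF _ e24, of _ 0]) simp_all
  have e35: "br e3 e5 = br e1 (br e3 e4)"
    using br_leibniz[of e1 e3 e4] by (simp add: br_self flip: e)
  have e35_26: "br e1 (br e2 e5) = br e3 e5 + br e2 e6"
    using br_leibniz[of e1 e2 e5] by (simp flip: e)
  \<comment> \<open>Otherwise \<open>w = [e\<^sub>3, e\<^sub>4]\<close> spans \<open>D 4\<close> modulo \<open>D 5\<close>, and modulo \<open>D 6\<close> the bracket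
    \<open>[e\<^sub>1, w]\<close> equals both \<open>[e\<^sub>3, e\<^sub>5]\<close> and its negative.\<close>
  show w: "br e3 e4 \<in> D 5"
  proof (rule ccontr)
    assume w5: "br e3 e4 \<notin> D 5"
    define w where "w = br e3 e4"
    have "br (br e2 e3) e4 \<in> D 6" "br e3 (br e2 e4) \<in> D 6"
      using mem_D[OF e23 e4, of 6] mem_D[OF e3 e24, of 6] by (simp_all flip: e)
    then have e2w: "br e2 w \<in> D 6" using br_leibniz[of e2 e3 e4] D_simps(1) by (simp add: w_def)
    have e1w: "br e1 w \<notin> D 6" using G[of w 4] w4 w5 e2w by (simp add: w_def)
    \<comment> \<open>\<open>w\<close> spans \<open>D 4\<close> modulo \<open>D 5\<close>, so
      \<open>e6\<close> is a multiple of it there and inherits the bound on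
      \<open>[e2, w]\<close>.\<close>
    obtain s where "e6 - s *\<^sub>R w \<in> D (Suc 4)"
      using fl(3)[of 4 w e6] w4 w5 e6 by (auto simp: w_def)
    then have "br e2 (e6 - s *\<^sub>R w) \<in> D 6" using br_D by fastforce
    then have "br e2 (e6 - s *\<^sub>R w) + s *\<^sub>R br e2 w \<in> D 6" using e2w D_simps by blast
    then have e26: "br e2 e6 \<in> D 6" by (simp add: br_simps)
    have "br e1 (br e1 (br e2 e4)) \<in> D 6" by (rule mem_D[OF _ d5, of _ 0]) simp_all
    moreover have "br e1 (br e1 (br e2 e4)) = 2 *\<^sub>R br e1 w + br e2 e6"
      using e35_26 unfolding e34_25 e35 by (simp add: br_simps w_def scaleR_2)
    ultimately have "2 *\<^sub>R br e1 w + br e2 e6 \<in> D 6" by simp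
    then have "2 *\<^sub>R br e1 w + br e2 e6 - br e2 e6 \<in> D 6" using e26 by (rule D_simps(2))
    then have "2 *\<^sub>R br e1 w \<in> D 6" by simp
    then have "(1/2) *\<^sub>R 2 *\<^sub>R br e1 w \<in> D 6" by (rule D_simps(3))
    then show False using e1w by simp
  qed
  have e25: "br e2 e5 \<in> D 5" using D_simps(2)[OF d5 w] by (simp add: e34_25)
  show e6': "e6 \<notin> D 5"
    using G[OF e5] e5' e25 e by simp
  have "br e1 (br e2 e5) \<in> D 6" by (rule mem_D[OF _ e25, of _ 0]) simp_all
  moreover have "br e3 e5 \<in> D 6" unfolding e35 by (rule mem_D[OF _ w, of _ 0]) simp_all
  ultimately have "br e1 (br e2 e5) - br e3 e5 \<in> D 6" by (rule D_simps(2))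
  then have e26: "br e2 e6 \<in> D 6" by (simp add: e35_26)
  show e7': "e7 \<notin> D 6"
    using G[OF e6] e6' e26 e by simp
  show "br e1 e7 \<noteq> 0 \<or> br e2 e7 \<noteq> 0" using zero[OF e7 e7'] by blast
qed

text \<open>The basis consists of eigenvectors of \<open>T\<close>, so a nonzero structure constant
  forces two weights to agree. The two values of \<open>\<nu>\<close> record whether
  \<open>[e1, e7]\<close> or only \<open>[e2, e7]\<close> reaches the last basis vector.\<close>

lemma filiform8_graded_isomorphic_gbr:
  assumes dim: "dim (UNIV :: 'a set) = 8" and fil: "filiform br" and gr: "N_graded br"
  obtains p q \<nu> \<tau> u2 s2 u3 s3 u4 u5 :: real where
    "lie_isomorphic (gbr \<nu> \<tau> u2 s2 u3 s3 u4 u5) br" "p > 0" "q > 0"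
    "\<nu> = 1 \<or> \<nu> = 0 \<and> \<tau> = 1" "\<tau> * (s2 + 2 * u2) = 0"
    "u2 \<noteq> 0 \<Longrightarrow> q = 2 * p" "s2 \<noteq> 0 \<Longrightarrow> q = 2 * p" "u3 \<noteq> 0 \<Longrightarrow> q = 3 * p" "u4 \<noteq> 0 \<Longrightarrow> q = 4 * p"
    "\<nu> = 1 \<Longrightarrow> s3 \<noteq> 0 \<Longrightarrow> q = 3 * p" "\<nu> = 1 \<Longrightarrow> u5 \<noteq> 0 \<Longrightarrow> q = 5 * p" "\<nu> = 1 \<Longrightarrow> \<tau> \<noteq> 0 \<Longrightarrow> q = p"
    "\<nu> = 0 \<Longrightarrow> s3 = 0 \<and> u5 = 0"
proof -
  note result = that
  obtain T where T: "linear T" "\<And>x y. T (br x y) = br (T x) y + br x (T y)"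
    and sp: "span {x. \<exists>w>0. T x = w *\<^sub>R x} = UNIV"
    by (rule N_graded_imp_derivation[OF real_lie_algebra_axioms gr]) (rule that)
  have n4: "8 \<ge> (4 :: nat)" by simp
  obtain e1 e2 p q where pq: "p > 0" "q > 0" and T1: "T e1 = p *\<^sub>R e1" and T2: "T e2 = q *\<^sub>R e2"
    and gen: "\<And>z. \<exists>s t. z - s *\<^sub>R e1 - t *\<^sub>R e2 \<in> D 1" and e23: "br e2 (br e1 e2) \<in> D 3"
    by (rule homogeneous_generators[OF dim n4 fil T sp]) (rule that)
  define e3 e4 e5 e6 e7 where e: "e3 = br e1 e2" "e4 = br e1 e3" "e5 = br e1 e4" "e6 = br e1 e5" "e7 = br e1 e6"
  note ch = filiform8_chain[OF dim fil gen e23 e]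
  note fl = filiform_lower_central[OF dim _ fil, simplified]
  define \<nu> :: real where "\<nu> = (if br e1 e7 = 0 then 0 else 1)"
  \<comment> \<open>The minus sign makes \<open>\<tau> = 1\<close> when
    \<open>\<nu> = 0\<close>.\<close>
  define e8 where "e8 = (if br e1 e7 = 0 then - br e2 e7 else br e1 e7)"
  have b6: "br a e7 \<in> D 6" for a by (rule mem_D[OF _ ch(9), of _ 0]) simp_all
  have e8: "e8 \<in> D 6" "e8 \<noteq> 0" using b6 D_simps(5) ch(12) by (auto simp: e8_def)
  have x6: "\<exists>s. z = s *\<^sub>R e8" if "z \<in> D 6" for z
    using fl(3)[of 6 e8 z] e8 fl(1) that by simp
  have x5: "\<exists>s t. z = s *\<^sub>R e7 + t *\<^sub>R e8" if z: "z \<in> D 5" for z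
  proof -
    obtain s where "z - s *\<^sub>R e7 \<in> D 6" using fl(3)[of 5 e7 z] ch z by auto
    then obtain t where "z - s *\<^sub>R e7 = t *\<^sub>R e8" using x6 by blast
    then have "z = s *\<^sub>R e7 + t *\<^sub>R e8" by (simp add: algebra_simps)
    then show ?thesis by blast
  qed
  have x3: "\<exists>r r' s t. z = r *\<^sub>R e5 + r' *\<^sub>R e6 + s *\<^sub>R e7 + t *\<^sub>R e8" if z: "z \<in> D 3" for z
  proof -
    obtain r where r: "z - r *\<^sub>R e5 \<in> D 4" using fl(3)[of 3 e5 z] ch z by auto
    obtain r' where "z - r *\<^sub>R e5 - r' *\<^sub>R e6 \<in> D 5" using fl(3)[of 4 e6, OF _ _ _ r] ch by auto
    then obtain s t where "z - r *\<^sub>R e5 - r' *\<^sub>R e6 = s *\<^sub>R e7 + t *\<^sub>R e8" using x5 by blast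
    then have "z = r *\<^sub>R e5 + r' *\<^sub>R e6 + s *\<^sub>R e7 + t *\<^sub>R e8" by (simp add: algebra_simps)
    then show ?thesis by blast
  qed
  have D7: "z = 0" if "z \<in> D 7" for z using that fl(1) by simp
  have z0: "br a b = 0" if "a \<in> D i" "b \<in> D j" "6 \<le> i + j" for a b i j
    using D7[OF mem_D[OF that(1,2)]] that(3) by simp
  have D0: "a \<in> D 0" for a by simp

  \<comment> \<open>Structure constants\<close>
  obtain u2 u3 u4 u5 where b23: "br e2 e3 = u2 *\<^sub>R e5 + u3 *\<^sub>R e6 + u4 *\<^sub>R e7 + u5 *\<^sub>R e8"
    using x3[OF e23] unfolding e(1) by blast
  obtain s2 s3 where b34: "br e3 e4 = s2 *\<^sub>R e7 + s3 *\<^sub>R e8"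
    using x5[OF ch(11)] by blast
  have "br e3 e6 \<in> D 6" by (rule mem_D[OF ch(1,7)]) simp
  then obtain \<tau> where b36: "br e3 e6 = \<tau> *\<^sub>R e8" using x6 by blast
  have b17: "br e1 e7 = \<nu> *\<^sub>R e8" by (simp add: \<nu>_def e8_def)
  have b18: "br e1 e8 = 0" "br e2 e8 = 0" "br e3 e8 = 0" "br e4 e8 = 0" "br e5 e8 = 0" "br e6 e8 = 0"
    "br e7 e8 = 0"
    using z0[OF D0 e8(1)] by simp_all
  have b0: "br e3 e7 = 0" "br e4 e6 = 0" "br e4 e7 = 0" "br e5 e6 = 0" "br e5 e7 = 0" "br e6 e7 = 0"
    using z0[OF ch(1,9)] z0[OF ch(3,7)] z0[OF ch(3,9)] z0[OF ch(5,7)] z0[OF ch(5,9)] z0[OF ch(7,9)]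
    by simp_all
  note es = e[symmetric]
  have b24: "br e2 e4 = u2 *\<^sub>R e6 + u3 *\<^sub>R e7 + (\<nu> * u4) *\<^sub>R e8"
    using br_leibniz[of e1 e2 e3] by (simp add: es br_self b23 br_simps b17 b18 mult.commute)
  have b25: "br e2 e5 = (u2 - s2) *\<^sub>R e7 + (\<nu> * u3 - s3) *\<^sub>R e8"
  proof -
    have "br e2 e5 = br e1 (br e2 e4) - br e3 e4" using br_leibniz[of e1 e2 e4] by (simp add: es)
    then show ?thesis by (simp add: b24 b34 es br_simps b17 b18 algebra_simps)
  qed
  have b35: "br e3 e5 = (\<nu> * s2) *\<^sub>R e8"
    using br_leibniz[of e1 e3 e4] by (simp add: es br_self b34 br_simps b17 b18 mult.commute)
  have b26: "br e2 e6 = (\<nu> * (u2 - 2 * s2)) *\<^sub>R e8"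
  proof -
    have "br e2 e6 = br e1 (br e2 e5) - br e3 e5" using br_leibniz[of e1 e2 e5] by (simp add: es)
    also have "\<dots> = ((u2 - s2) * \<nu>) *\<^sub>R e8 - (\<nu> * s2) *\<^sub>R e8"
      by (simp add: b25 b35 es br_simps b17 b18)
    also have "\<dots> = (\<nu> * (u2 - 2 * s2)) *\<^sub>R e8"
      unfolding scaleR_diff_left[symmetric] by (rule arg_cong[where f = "\<lambda>c. c *\<^sub>R e8"]) (simp add: algebra_simps)
    finally show ?thesis .
  qed
  have b45: "br e4 e5 = - \<tau> *\<^sub>R e8"
  proof -
    have "br e4 e5 = br e1 (br e3 e5) - br e3 e6" using br_leibniz[of e1 e3 e5] by (simp add: es)
    then show ?thesis by (simp add: b35 b36 br_simps b18)
  qed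
  have b27: "br e2 e7 = - \<tau> *\<^sub>R e8"
  proof -
    have "br e2 e7 = br e1 (br e2 e6) - br e3 e6" using br_leibniz[of e1 e2 e6] by (simp add: es)
    then show ?thesis by (simp add: b26 b36 br_simps b18)
  qed
  note table = es(1) es(2-5) b17 b18(1) b23 b24 b25 b26 b27 b18(2) b34 b35 b36 b0(1) b18(3) b45 b0(2,3)
    b18(4) b0(4,5) b18(5) b0(6) b18(6,7)
  have \<nu>\<tau>: "\<nu> = 1 \<or> \<nu> = 0 \<and> \<tau> = 1"
  proof (cases "br e1 e7 = 0")
    case True
    then have "e8 = \<tau> *\<^sub>R e8" using b27 by (simp add: e8_def)
    then have "(\<tau> - 1) *\<^sub>R e8 = 0" by (simp add: algebra_simps)
    then show ?thesis using e8 True by (simp add: \<nu>_def)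
  qed (simp add: \<nu>_def)
  \<comment> \<open>The Jacobi identity for \<open>e2\<close>, \<open>e3\<close>, \<open>e4\<close>,
    in which only multiples of \<open>e8\<close> remain.\<close>
  have jac: "\<tau> * (s2 + 2 * u2) = 0"
  proof -
    have "br e5 e4 = \<tau> *\<^sub>R e8" "br e6 e4 = 0" "br e7 e4 = 0" "br e8 e4 = 0"
      using skew[of e5 e4] skew[of e6 e4] skew[of e7 e4] skew[of e8 e4] by (simp_all add: b45 b0 b18)
    then have "- ((s2 * \<tau>) *\<^sub>R e8) = (u2 * \<tau>) *\<^sub>R e8 + (u2 * \<tau>) *\<^sub>R e8"
      using br_leibniz[of e2 e3 e4] by (simp add: b34 b23 b24 br_simps b27 b18 b36 b0)
    then have "(- (s2 * \<tau>)) *\<^sub>R e8 = (u2 * \<tau> + u2 * \<tau>) *\<^sub>R e8"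
      by (simp only: scaleR_minus_left scaleR_add_left)
    then have "- (s2 * \<tau>) = u2 * \<tau> + u2 * \<tau>" using e8(2) by (simp only: scaleR_cancel_right) simp
    then show ?thesis by (simp add: algebra_simps)
  qed

  \<comment> \<open>Linear independence\<close>
  have ind: "c1 = 0 \<and> c2 = 0 \<and> c3 = 0 \<and> c4 = 0 \<and> c5 = 0 \<and> c6 = 0 \<and> c7 = 0 \<and> c8 = 0"
    if eq: "c1 *\<^sub>R e1 + c2 *\<^sub>R e2 + c3 *\<^sub>R e3 + c4 *\<^sub>R e4 + c5 *\<^sub>R e5 + c6 *\<^sub>R e6 + c7 *\<^sub>R e7 + c8 *\<^sub>R e8 = 0"
    for c1 c2 c3 c4 c5 c6 c7 c8
  proof -
    have zero: "c = 0" if "c *\<^sub>R v \<in> S" "v \<notin> S" "subspace S" for c v and S :: "'a set"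
      using subspace_scale_cancel that by blast
    have c12: "c1 *\<^sub>R e1 + c2 *\<^sub>R e2 = - (c3 *\<^sub>R e3 + c4 *\<^sub>R e4 + c5 *\<^sub>R e5 + c6 *\<^sub>R e6 + c7 *\<^sub>R e7 + c8 *\<^sub>R e8)"
      using eq by (simp only: scaleR_zero_left add_0_left eq_neg_iff_add_eq_0 add.assoc)
    have up: "e4 \<in> D 1" "e5 \<in> D 1" "e6 \<in> D 1" "e7 \<in> D 1" "e8 \<in> D 1"
      "e5 \<in> D 2" "e6 \<in> D 2" "e7 \<in> D 2" "e8 \<in> D 2"
      "e6 \<in> D 3" "e7 \<in> D 3" "e8 \<in> D 3" "e7 \<in> D 4" "e8 \<in> D 4" "e8 \<in> D 5"
      using ch(3,5,7,9) e8(1) D_antimono[of 1 2] D_antimono[of 1 3] D_antimono[of 1 4] D_antimono[of 1 5]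
        D_antimono[of 1 6] D_antimono[of 2 3] D_antimono[of 2 4] D_antimono[of 2 5] D_antimono[of 2 6]
        D_antimono[of 3 4] D_antimono[of 3 5] D_antimono[of 3 6] D_antimono[of 4 5] D_antimono[of 4 6]
        D_antimono[of 5 6] by auto
    have m: "c1 *\<^sub>R e1 + c2 *\<^sub>R e2 \<in> D 1"
      unfolding c12 by (intro D_simps up ch)
    \<comment> \<open>Bracketing with \<open>e2\<close> and \<open>e1\<close> isolates
      \<open>c1 e3\<close> and \<open>c2 e3\<close>, and \<open>e3\<close> is not in
      \<open>D 2\<close>. The other coefficients are then peeled off along the series.\<close>
    have "br (c1 *\<^sub>R e1 + c2 *\<^sub>R e2) e2 \<in> D 2" "br e1 (c1 *\<^sub>R e1 + c2 *\<^sub>R e2) \<in> D 2"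
      using br_D[OF m] br_D'[OF m] by (simp_all add: numeral_2_eq_2)
    then have "c1 *\<^sub>R e3 \<in> D 2" "c2 *\<^sub>R e3 \<in> D 2" by (simp_all add: br_simps br_self es)
    then have c1: "c1 = 0" and c2: "c2 = 0" using zero ch(2) subspace_lower_central by blast+
    have "c3 *\<^sub>R e3 = - (c4 *\<^sub>R e4 + c5 *\<^sub>R e5 + c6 *\<^sub>R e6 + c7 *\<^sub>R e7 + c8 *\<^sub>R e8)"
      using eq by (simp only: c1 c2 scaleR_zero_left add_0_left eq_neg_iff_add_eq_0 add.assoc)
    also have "\<dots> \<in> D 2" by (intro D_simps up ch)
    finally have c3: "c3 = 0" using zero ch(2) subspace_lower_central by blast
    have "c4 *\<^sub>R e4 = - (c5 *\<^sub>R e5 + c6 *\<^sub>R e6 + c7 *\<^sub>R e7 + c8 *\<^sub>R e8)"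
      using eq by (simp only: c1 c2 c3 scaleR_zero_left add_0_left eq_neg_iff_add_eq_0 add.assoc)
    also have "\<dots> \<in> D 3" by (intro D_simps up ch)
    finally have c4: "c4 = 0" using zero ch(4) subspace_lower_central by blast
    have "c5 *\<^sub>R e5 = - (c6 *\<^sub>R e6 + c7 *\<^sub>R e7 + c8 *\<^sub>R e8)"
      using eq by (simp only: c1 c2 c3 c4 scaleR_zero_left add_0_left eq_neg_iff_add_eq_0 add.assoc)
    also have "\<dots> \<in> D 4" by (intro D_simps up ch)
    finally have c5: "c5 = 0" using zero ch(6) subspace_lower_central by blast
    have "c6 *\<^sub>R e6 = - (c7 *\<^sub>R e7 + c8 *\<^sub>R e8)"
      using eq by (simp only: c1 c2 c3 c4 c5 scaleR_zero_left add_0_left eq_neg_iff_add_eq_0 add.assoc)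
    also have "\<dots> \<in> D 5" by (intro D_simps up ch)
    finally have c6: "c6 = 0" using zero ch(8) subspace_lower_central by blast
    have "c7 *\<^sub>R e7 = - (c8 *\<^sub>R e8)"
      using eq by (simp only: c1 c2 c3 c4 c5 c6 scaleR_zero_left add_0_left eq_neg_iff_add_eq_0 add.assoc)
    also have "\<dots> \<in> D 6" by (intro D_simps e8)
    finally have c7: "c7 = 0" using zero ch(10) subspace_lower_central by blast
    show ?thesis using eq e8 by (simp add: c1 c2 c3 c4 c5 c6 c7)
  qed
  have ind4: "c5 = 0 \<and> c6 = 0 \<and> c7 = 0 \<and> c8 = 0"
    if "c5 *\<^sub>R e5 + c6 *\<^sub>R e6 + c7 *\<^sub>R e7 + c8 *\<^sub>R e8 = 0" for c5 c6 c7 c8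
    using ind[of 0 0 0 0 c5 c6 c7 c8] that by simp
  have ind2: "c7 = 0 \<and> c8 = 0" if "c7 *\<^sub>R e7 + c8 *\<^sub>R e8 = 0" for c7 c8
    using ind4[of 0 0 c7 c8] that by simp

  \<comment> \<open>Weights\<close>
  have T3: "T e3 = (p + q) *\<^sub>R e3" unfolding e(1) T(2) T1 T2 br_simps scaleR_add_left ..
  have T4: "T e4 = (2 * p + q) *\<^sub>R e4"
    unfolding e(2) T(2) T1 T3 br_simps scaleR_add_left[symmetric] by simp
  have T5: "T e5 = (3 * p + q) *\<^sub>R e5"
    unfolding e(3) T(2) T1 T4 br_simps scaleR_add_left[symmetric] by simp
  have T6: "T e6 = (4 * p + q) *\<^sub>R e6"
    unfolding e(4) T(2) T1 T5 br_simps scaleR_add_left[symmetric] by simp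
  have T7: "T e7 = (5 * p + q) *\<^sub>R e7"
    unfolding e(5) T(2) T1 T6 br_simps scaleR_add_left[symmetric] by simp
  define w where "w = (if \<nu> = 1 then 6 * p + q else 5 * p + 2 * q)"
  have T8: "T e8 = w *\<^sub>R e8"
  proof (cases "br e1 e7 = 0")
    case True
    then have "T e8 = - T (br e2 e7)" "e8 = - br e2 e7" using linear_neg[OF T(1)] by (simp_all add: e8_def)
    then show ?thesis using True
      unfolding T(2) T2 T7 br_simps scaleR_add_left[symmetric] by (simp add: w_def \<nu>_def add_ac)
  next
    case False
    then have "T e8 = T (br e1 e7)" "e8 = br e1 e7" by (simp_all add: e8_def)
    then show ?thesis using False
      unfolding T(2) T1 T7 br_simps scaleR_add_left[symmetric] by (simp add: w_def \<nu>_def)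
  qed
  note Tl = linear_add[OF T(1)] linear_scale[OF T(1)]
  \<comment> \<open>\<open>[e2, e3]\<close> has weight \<open>p + 2 q\<close>, so by independence
    each of its terms has that weight or a zero coefficient.\<close>
  have "T (br e2 e3) - (p + 2 * q) *\<^sub>R br e2 e3 = 0"
    unfolding T(2) T2 T3 br_simps scaleR_add_left[symmetric] by (simp add: add_ac)
  then have "(u2 * (3 * p + q) - (p + 2 * q) * u2) *\<^sub>R e5 + (u3 * (4 * p + q) - (p + 2 * q) * u3) *\<^sub>R e6
    + (u4 * (5 * p + q) - (p + 2 * q) * u4) *\<^sub>R e7 + (u5 * w - (p + 2 * q) * u5) *\<^sub>R e8 = 0"
    unfolding b23 Tl T5 T6 T7 T8 scaleR_add_right scaleR_scaleR add_diff_add scaleR_diff_left[symmetric] .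
  then have w23: "u2 * (3 * p + q) - (p + 2 * q) * u2 = 0" "u3 * (4 * p + q) - (p + 2 * q) * u3 = 0"
    "u4 * (5 * p + q) - (p + 2 * q) * u4 = 0" "u5 * w - (p + 2 * q) * u5 = 0"
    by (blast dest: ind4)+
  have "T (br e3 e4) - (3 * p + 2 * q) *\<^sub>R br e3 e4 = 0"
    unfolding T(2) T3 T4 br_simps scaleR_add_left[symmetric] by (simp add: add_ac)
  then have "(s2 * (5 * p + q) - (3 * p + 2 * q) * s2) *\<^sub>R e7 + (s3 * w - (3 * p + 2 * q) * s3) *\<^sub>R e8 = 0"
    unfolding b34 Tl T7 T8 scaleR_add_right scaleR_scaleR add_diff_add scaleR_diff_left[symmetric] .
  then have w34: "s2 * (5 * p + q) - (3 * p + 2 * q) * s2 = 0" "s3 * w - (3 * p + 2 * q) * s3 = 0"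
    by (blast dest: ind2)+
  have "T (br e3 e6) - (5 * p + 2 * q) *\<^sub>R br e3 e6 = 0"
    unfolding T(2) T3 T6 br_simps scaleR_add_left[symmetric] by (simp add: add_ac)
  then have "(\<tau> * w - (5 * p + 2 * q) * \<tau>) *\<^sub>R e8 = 0"
    unfolding b36 Tl T8 scaleR_scaleR scaleR_diff_left[symmetric] .
  then have w36: "\<tau> * w - (5 * p + 2 * q) * \<tau> = 0" using e8 by simp

  \<comment> \<open>The isomorphism\<close>
  define f where "f x = x $ 1 *\<^sub>R e1 + x $ 2 *\<^sub>R e2 + x $ 3 *\<^sub>R e3 + x $ 4 *\<^sub>R e4 + x $ 5 *\<^sub>R e5
    + x $ 6 *\<^sub>R e6 + x $ 7 *\<^sub>R e7 + x $ 0 *\<^sub>R e8" for x :: "real^8"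
  have flin: "linear f" by (rule linearI) (simp_all add: f_def algebra_simps)
  have "inj f"
  proof (subst linear_injective_0[OF flin], intro allI impI)
    fix x assume "f x = 0"
    then show "x = 0" using ind[of "x$1" "x$2" "x$3" "x$4" "x$5" "x$6" "x$7" "x$0"]
      by (simp add: f_def vec_eq_iff forall_8)
  qed
  moreover have "\<exists>x. z = f x" for z
  proof -
    obtain a b where ab: "z - a *\<^sub>R e1 - b *\<^sub>R e2 \<in> D 1" using gen by blast
    obtain c where c: "z - a *\<^sub>R e1 - b *\<^sub>R e2 - c *\<^sub>R e3 \<in> D 2"
      using fl(3)[of 1 e3, OF _ _ _ ab] ch by (auto simp: numeral_2_eq_2)
    obtain d where d: "z - a *\<^sub>R e1 - b *\<^sub>R e2 - c *\<^sub>R e3 - d *\<^sub>R e4 \<in> D 3"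
      using fl(3)[of 2 e4, OF _ _ _ c] ch by auto
    obtain r r' s t where "z - a *\<^sub>R e1 - b *\<^sub>R e2 - c *\<^sub>R e3 - d *\<^sub>R e4
        = r *\<^sub>R e5 + r' *\<^sub>R e6 + s *\<^sub>R e7 + t *\<^sub>R e8"
      using x3[OF d] by blast
    then have "z = f (vec8 a b c d r r' s t)" by (simp add: f_def algebra_simps)
    then show ?thesis by blast
  qed
  ultimately have bij: "bij f" unfolding bij_def surj_def by blast
  let ?B = "gbr \<nu> \<tau> u2 s2 u3 s3 u4 u5"
  have fe: "f (eb 1) = e1" "f (eb 2) = e2" "f (eb 3) = e3" "f (eb 4) = e4" "f (eb 5) = e5"
    "f (eb 6) = e6" "f (eb 7) = e7" "f (eb 8) = e8"
    by (simp_all add: f_def eb_def axis_def)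
  note flins = linear_add[OF flin] linear_scale[OF flin] linear_neg[OF flin] linear_0[OF flin]
  have less: "f (?B (eb i) (eb j)) = br (f (eb i)) (f (eb j))" if "i \<in> {1..8}" "j \<in> {1..8}" "i < j" for i j
    using that unfolding atLeastAtMost_1_8
    by (auto simp: gbr_basis fe table flins simp del: One_nat_def)
  have self: "?B x x = 0" for x
    using gbr_skew[of \<nu> \<tau> u2 s2 u3 s3 u4 u5 x x] by (simp add: eq_neg_iff_add_eq_0 flip: scaleR_2)
  have on_basis: "f (?B (eb i) (eb j)) = br (f (eb i)) (f (eb j))" if "i \<in> {1..8}" "j \<in> {1..8}" for i j
  proof (cases i j rule: linorder_cases)
    case greater
    then show ?thesis
      using less[OF that(2,1)] gbr_skew[of \<nu> \<tau> u2 s2 u3 s3 u4 u5 "eb i" "eb j"] skew[of "f (eb i)" "f (eb j)"]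
      by (simp add: flins)
  qed (use less that in \<open>simp_all add: self br_self flins\<close>)
  have "x \<in> span (eb ` {1..8})" for x
  proof -
    have "x $ 8 = x $ 0" by (rule arg_cong[where f = "($) x"]) simp
    then have "x = (\<Sum>i\<in>{1..8}. x $ of_nat i *\<^sub>R eb i)"
      unfolding atLeastAtMost_1_8 by (simp add: vec_eq_iff forall_8 eb_def axis_def)
    also have "\<dots> \<in> span (eb ` {1..8})" by (intro span_sum span_scale span_base imageI)
    finally show ?thesis .
  qed
  then have sp8: "UNIV \<subseteq> span (eb ` {1..8})" by blast
  have hom: "f (?B x y) = br (f x) (f y)" for x y
  proof (rule bilinear_eq[OF _ _ sp8 sp8])
    show "bilinear (\<lambda>x y. f (?B x y))"
      using bilinear_gbr[of \<nu> \<tau> u2 s2 u3 s3 u4 u5] unfolding bilinear_def linear_iff by (simp add: flins)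
    show "bilinear (\<lambda>x y. br (f x) (f y))"
      unfolding bilinear_def linear_iff by (simp add: flins br_simps)
  qed (use on_basis in auto)
  have iso: "lie_isomorphic ?B br"
    unfolding lie_isomorphic_def using flin bij hom by blast
  have weights: "u2 * (q - 2 * p) = 0" "s2 * (q - 2 * p) = 0" "u3 * (q - 3 * p) = 0" "u4 * (q - 4 * p) = 0"
    "s3 * (w - (3 * p + 2 * q)) = 0" "u5 * (w - (p + 2 * q)) = 0" "\<tau> * (w - (5 * p + 2 * q)) = 0"
    using w23 w34 w36 by (simp_all add: algebra_simps) auto
  \<comment> \<open>For \<open>\<nu> = 0\<close> the weight \<open>w\<close> exceeds those of
    \<open>[e3, e4]\<close> and \<open>[e2, e3]\<close> by \<open>2 p\<close> and
    \<open>4 p\<close>, so \<open>p > 0\<close> kills \<open>s3\<close> and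
    \<open>u5\<close>.\<close>
  show thesis
    by (rule result[OF iso pq \<nu>\<tau> jac]) (use weights pq in \<open>auto simp: w_def\<close>)
qed

end

subsection \<open>Normal forms\<close>

lemma lie_isomorphic_refl: "lie_isomorphic br br"
  unfolding lie_isomorphic_def by (intro exI[of _ "\<lambda>x. x"]) (simp add: linear_id[unfolded id_def] bij_id[unfolded id_def])

lemma lie_isomorphic_sym:
  assumes "lie_isomorphic br br'"
  shows "lie_isomorphic br' br"
proof -
  obtain f where f: "linear f" "bij f" "\<And>x y. f (br x y) = br' (f x) (f y)"
    using assms unfolding lie_isomorphic_def by blast
  have "linear (inv f)"
    using f(1,2) by (auto simp: linear_iff bij_is_surj surj_f_inv_f intro!: inv_f_eq[OF bij_is_inj])
  moreover have "inv f (br' x y) = br (inv f x) (inv f y)" for x y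
    using f(2,3) by (auto simp: bij_is_surj surj_f_inv_f intro!: inv_f_eq[OF bij_is_inj])
  ultimately show ?thesis
    using bij_imp_bij_inv[OF f(2)] unfolding lie_isomorphic_def by blast
qed

lemma lie_isomorphic_trans:
  assumes "lie_isomorphic br br'" "lie_isomorphic br' br''"
  shows "lie_isomorphic br br''"
proof -
  obtain f g where f: "linear f" "bij f" "\<And>x y. f (br x y) = br' (f x) (f y)"
    and g: "linear g" "bij g" "\<And>x y. g (br' x y) = br'' (g x) (g y)"
    using assms unfolding lie_isomorphic_def by blast
  have "linear (g \<circ> f)" "bij (g \<circ> f)" "\<And>x y. (g \<circ> f) (br x y) = br'' ((g \<circ> f) x) ((g \<circ> f) y)"
    using f g by (simp_all add: linear_compose bij_comp)
  then show ?thesis unfolding lie_isomorphic_def by blast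
qed

lemma lie_isomorphicI:
  fixes f g :: "real^8 \<Rightarrow> real^8"
  assumes "linear f" "\<And>x. g (f x) = x" "\<And>x. f (g x) = x" "\<And>x y. f (br x y) = br' (f x) (f y)"
  shows "lie_isomorphic br br'"
  unfolding lie_isomorphic_def using assms by (intro exI[of _ f]) (auto intro: o_bij[of g] simp: fun_eq_iff)

text \<open>Keep \<open>e1\<close> and multiply \<open>e2, ..., e8\<close> by \<open>c\<close>:
  brackets with \<open>e1\<close> are unchanged, while the others are quadratic in \<open>c\<close>
  and their constants get divided by it.\<close>

lemma gbr_scale:
  assumes "c \<noteq> 0"
  shows "lie_isomorphic (gbr 1 \<tau> u2 s2 u3 s3 u4 u5)
    (gbr 1 (\<tau> / c) (u2 / c) (s2 / c) (u3 / c) (s3 / c) (u4 / c) (u5 / c))"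
  by (rule lie_isomorphicI[of
      "\<lambda>x. vec8 (x $ 1) (c * x $ 2) (c * x $ 3) (c * x $ 4) (c * x $ 5) (c * x $ 6) (c * x $ 7) (c * x $ 0)"
      "\<lambda>x. vec8 (x $ 1) (x $ 2 / c) (x $ 3 / c) (x $ 4 / c) (x $ 5 / c) (x $ 6 / c) (x $ 7 / c) (x $ 0 / c)"])
    (use assms in \<open>simp_all add: linear_iff vec_eq_iff forall_8 gbr_def Let_def field_simps\<close>)

text \<open>With \<open>\<nu> = 0\<close>, \<open>e8\<close> arises only from brackets among the
  rescaled vectors, so it is multiplied by \<open>c\<^sup>2\<close>, which keeps
  \<open>\<tau> = 1\<close>.\<close>

lemma gbr_scale_twisted:
  assumes "c \<noteq> 0"
  shows "lie_isomorphic (gbr 0 1 u2 s2 u3 0 u4 0) (gbr 0 1 (u2 / c) (s2 / c) (u3 / c) 0 (u4 / c) 0)"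
  by (rule lie_isomorphicI[of
      "\<lambda>x. vec8 (x $ 1) (c * x $ 2) (c * x $ 3) (c * x $ 4) (c * x $ 5) (c * x $ 6) (c * x $ 7) (c\<^sup>2 * x $ 0)"
      "\<lambda>x. vec8 (x $ 1) (x $ 2 / c) (x $ 3 / c) (x $ 4 / c) (x $ 5 / c) (x $ 6 / c) (x $ 7 / c) (x $ 0 / c\<^sup>2)"])
    (use assms in \<open>simp_all add: linear_iff vec_eq_iff forall_8 gbr_def Let_def field_simps power2_eq_square\<close>)

text \<open>In the target \<open>[e1, e7] = [e2, e7] = e8\<close>, so \<open>e1 - e2\<close>
  commutes with \<open>e7\<close>. Taking it as first vector gives \<open>\<nu> = 0\<close>, and
  flipping \<open>e8\<close> gives \<open>\<tau> = 1\<close>.\<close>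

lemma gbr_m1_alternative: "lie_isomorphic (gbr 0 1 0 0 0 0 0 0) (gbr 1 (- 1) 0 0 0 0 0 0)"
  by (rule lie_isomorphicI[of
      "\<lambda>x. vec8 (x $ 1) (x $ 2 - x $ 1) (x $ 3) (x $ 4) (x $ 5) (x $ 6) (x $ 7) (- x $ 0)"
      "\<lambda>x. vec8 (x $ 1) (x $ 2 + x $ 1) (x $ 3) (x $ 4) (x $ 5) (x $ 6) (x $ 7) (- x $ 0)"])
    (simp_all add: linear_iff vec_eq_iff forall_8 gbr_def Let_def algebra_simps)

text \<open>For \<open>\<nu> = 1\<close> the ratio \<open>q / p\<close> lets at most one of the
  groups \<open>\<tau>\<close>; \<open>u2, s2\<close>; \<open>u3, s3\<close>; \<open>u4\<close>;
  \<open>u5\<close> be nonzero. Scaling normalizes one constant; in the two-element groups the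
  remaining ratio is the parameter of a family.\<close>

lemma gbr_normal_form:
  fixes p q :: real
  assumes pq: "p > 0" "q > 0"
    and \<nu>\<tau>: "\<nu> = 1 \<or> \<nu> = 0 \<and> \<tau> = 1" and jac: "\<tau> * (s2 + 2 * u2) = 0"
    and w: "u2 \<noteq> 0 \<Longrightarrow> q = 2 * p" "s2 \<noteq> 0 \<Longrightarrow> q = 2 * p" "u3 \<noteq> 0 \<Longrightarrow> q = 3 * p" "u4 \<noteq> 0 \<Longrightarrow> q = 4 * p"
    "\<nu> = 1 \<Longrightarrow> s3 \<noteq> 0 \<Longrightarrow> q = 3 * p" "\<nu> = 1 \<Longrightarrow> u5 \<noteq> 0 \<Longrightarrow> q = 5 * p" "\<nu> = 1 \<Longrightarrow> \<tau> \<noteq> 0 \<Longrightarrow> q = p"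
    "\<nu> = 0 \<Longrightarrow> s3 = 0 \<and> u5 = 0"
  shows "\<exists>L. lie_isomorphic (gbr \<nu> \<tau> u2 s2 u3 s3 u4 u5) (mu L)"
  using \<nu>\<tau>
proof
  assume \<nu>: "\<nu> = 1"
  note sc = gbr_scale[of _ \<tau> u2 s2 u3 s3 u4 u5]
  consider "\<tau> \<noteq> 0" | "\<tau> = 0" "s2 \<noteq> 0" | "\<tau> = 0" "s2 = 0" "u2 \<noteq> 0" | "\<tau> = 0" "s2 = 0" "u2 = 0" "s3 \<noteq> 0"
    | "\<tau> = 0" "s2 = 0" "u2 = 0" "s3 = 0" "u3 \<noteq> 0" | "\<tau> = 0" "s2 = 0" "u2 = 0" "s3 = 0" "u3 = 0" "u4 \<noteq> 0"
    | "\<tau> = 0" "s2 = 0" "u2 = 0" "s3 = 0" "u3 = 0" "u4 = 0" "u5 \<noteq> 0"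
    | "\<tau> = 0" "s2 = 0" "u2 = 0" "s3 = 0" "u3 = 0" "u4 = 0" "u5 = 0"
    by argo
  then show ?thesis
  proof cases
    case 1
    then have "u2 = 0" "s2 = 0" "u3 = 0" "s3 = 0" "u4 = 0" "u5 = 0" using w(1-7) \<nu> pq by fastforce+
    then show ?thesis using sc[of "- \<tau>"] 1 \<nu> by (intro exI[of _ L_m1]) (simp add: mu_eq_gbr)
  next
    case 2
    then have "u3 = 0" "s3 = 0" "u4 = 0" "u5 = 0" using w(2-6) \<nu> pq by fastforce+
    \<comment> \<open>Scaling \<open>s2\<close> to 1 turns \<open>u2\<close> into
      \<open>u2 / s2\<close>, which is \<open>2 + \<alpha>\<close> in the list.\<close>
    then show ?thesis using sc[of s2] 2 \<nu> by (intro exI[of _ "L_g (u2 / s2 - 2)"]) (simp add: mu_eq_gbr)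
  next
    case 3
    then have "u3 = 0" "s3 = 0" "u4 = 0" "u5 = 0" using w(1-6) \<nu> pq by fastforce+
    then show ?thesis using sc[of u2] 3 \<nu> by (intro exI[of _ L_m2]) (simp add: mu_eq_gbr)
  next
    case 4
    then have "u4 = 0" "u5 = 0" using w(4-6) \<nu> pq by fastforce+
    then show ?thesis using sc[of s3] 4 \<nu> by (intro exI[of _ "L_a (u3 / s3 - 1)"]) (simp add: mu_eq_gbr)
  next
    case 5
    then have "u4 = 0" "u5 = 0" using w(3-6) \<nu> pq by fastforce+
    then show ?thesis using sc[of u3] 5 \<nu> by (intro exI[of _ L_c10]) (simp add: mu_eq_gbr)
  next
    case 6
    then have "u5 = 0" using w(4,6) \<nu> pq by fastforce
    then show ?thesis using sc[of u4] 6 \<nu> by (intro exI[of _ L_d1]) (simp add: mu_eq_gbr)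
  next
    case 7
    then show ?thesis using sc[of u5] \<nu> by (intro exI[of _ L_h1]) (simp add: mu_eq_gbr)
  next
    case 8
    then show ?thesis using \<nu> lie_isomorphic_refl by (intro exI[of _ L_m0]) (simp add: mu_eq_gbr)
  qed
next
  assume "\<nu> = 0 \<and> \<tau> = 1"
  then have \<nu>: "\<nu> = 0" "\<tau> = 1" "s3 = 0" "u5 = 0" and s2: "s2 = - 2 * u2" using w(8) jac by auto
  note sc = gbr_scale_twisted[of _ u2 s2 u3 u4]
  consider "u2 \<noteq> 0" | "u2 = 0" "u3 \<noteq> 0" | "u2 = 0" "u3 = 0" "u4 \<noteq> 0" | "u2 = 0" "u3 = 0" "u4 = 0"
    by argo
  then show ?thesis
  proof cases
    case 1
    then have "u3 = 0" "u4 = 0" using w(1-4) pq by fastforce+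
    \<comment> \<open>Jacobi fixes the ratio \<open>u2 / s2 = - 1 / 2\<close>, so this case gives a
      single algebra instead of a family.\<close>
    then show ?thesis using sc[of s2] 1 \<nu> s2 by (intro exI[of _ L_b]) (simp add: mu_eq_gbr)
  next
    case 2
    then have "u4 = 0" using w(3,4) pq by fastforce
    then show ?thesis using sc[of u3] 2 \<nu> s2 by (intro exI[of _ L_k1]) (simp add: mu_eq_gbr)
  next
    case 3
    then show ?thesis using sc[of u4] \<nu> s2 by (intro exI[of _ L_s1]) (simp add: mu_eq_gbr)
  next
    case 4
    then show ?thesis using gbr_m1_alternative \<nu> s2 by (intro exI[of _ L_m1]) (simp add: mu_eq_gbr)
  qed
qed

theorem theorem3p10:
  fixes br :: "'a::real_vector \<Rightarrow> 'a \<Rightarrow> 'a"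
  assumes "real_lie_algebra br"
    and "dim (UNIV :: 'a set) = 8"
    and "filiform br"
    and "N_graded br"
  shows "\<exists>!L :: label. lie_isomorphic br (mu L)"
proof -
  interpret real_lie_algebra br by fact
  obtain p q \<nu> \<tau> u2 s2 u3 s3 u4 u5 :: real where
    iso: "lie_isomorphic (gbr \<nu> \<tau> u2 s2 u3 s3 u4 u5) br" and *: "p > 0" "q > 0"
    "\<nu> = 1 \<or> \<nu> = 0 \<and> \<tau> = 1" "\<tau> * (s2 + 2 * u2) = 0"
    "u2 \<noteq> 0 \<Longrightarrow> q = 2 * p" "s2 \<noteq> 0 \<Longrightarrow> q = 2 * p" "u3 \<noteq> 0 \<Longrightarrow> q = 3 * p" "u4 \<noteq> 0 \<Longrightarrow> q = 4 * p"
    "\<nu> = 1 \<Longrightarrow> s3 \<noteq> 0 \<Longrightarrow> q = 3 * p" "\<nu> = 1 \<Longrightarrow> u5 \<noteq> 0 \<Longrightarrow> q = 5 * p" "\<nu> = 1 \<Longrightarrow> \<tau> \<noteq> 0 \<Longrightarrow> q = p"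
    "\<nu> = 0 \<Longrightarrow> s3 = 0 \<and> u5 = 0"
    by (rule filiform8_graded_isomorphic_gbr[OF assms(2-4)]) (rule that)
  obtain L where "lie_isomorphic (gbr \<nu> \<tau> u2 s2 u3 s3 u4 u5) (mu L)"
    using gbr_normal_form[OF *] by blast
  then have L: "lie_isomorphic br (mu L)"
    by (rule lie_isomorphic_trans[OF lie_isomorphic_sym[OF iso]])
  show ?thesis
  proof (rule ex1I[of _ L])
    fix L' assume "lie_isomorphic br (mu L')"
    then have "lie_isomorphic (mu L') (mu L)"
      using L lie_isomorphic_sym lie_isomorphic_trans by blast
    then show "L' = L" by (rule lie_isomorphic_mu_imp_eq)
  qed (rule L)
qed

end
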